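(* Let $m,p\ge 1$ be integers and let $(a_n)_{n\in\mathbb{Z}}$, $(b_n)_{n\in\mathbb{Z}}$ be sequences of matrices in $\mathbb{C}^{m\times m}$ such that $a_{n+p}=a_n$, $b_{n+p}=b_n$ and $b_n=b_n^*$ for all $n\in\mathbb{Z}$. Let $\mathcal{J}:\ell^2_m(\mathbb{Z})\to\ell^2_m(\mathbb{Z})$ be the periodic Jacobi operator $$(\mathcal{J}y)_n=a_{n-1}^*y_{n-1}+b_ny_n+a_ny_{n+1},\qquad y_n\in\mathbb{C}^m,\ n\in\mathbb{Z}.$$ Then $$\mathrm{mes}(\sigma(\mathcal{J}))\le 4\min_{n}\mathrm{Tr}\bigl((a_n^*a_n)^{1/2}\bigr).$$
   Context: $\ell^2_m(\mathbb{Z})$ is the Hilbert space of square-summable sequences $(y_n)_{n\in\mathbb{Z}}$ with $y_n\in\mathbb{C}^m$. $\sigma(\cdot)$ denotes the spectrum, $\mathrm{mes}$ is Lebesgue measure on $\mathbb{R}$, $^*$ is the Hermitian conjugate, $(a_n^*a_n)^{1/2}$ is the positive-semidefinite square root, and the trace is taken of this square root. The minimum is over $n\in\mathbb{Z}$ (equivalently over one period). *)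

theory Defs
  imports "HOL-Analysis.Analysis"
begin

subsection \<open>The Hilbert space of square-summable sequences\<close>

text \<open>The space is a set of functions; the norm on \<^typ>\<open>complex ^ 'm\<close> is the Euclidean one.\<close>

definition ell2 :: "(int \<Rightarrow> complex ^ 'm) set" where
  "ell2 = {y. (\<lambda>n. (norm (y n))\<^sup>2) summable_on UNIV}"

definition ell2_norm :: "(int \<Rightarrow> complex ^ 'm) \<Rightarrow> real" where
  "ell2_norm y = sqrt (\<Sum>\<^sub>\<infinity>n\<in>UNIV. (norm (y n))\<^sup>2)"

text \<open>Operators are total functions on sequences of which only the restriction to \<^const>\<open>ell2\<close>
  matters.\<close>

definition bounded_operator :: "((int \<Rightarrow> complex ^ 'm) \<Rightarrow> int \<Rightarrow> complex ^ 'm) \<Rightarrow> bool" where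
  "bounded_operator T \<longleftrightarrow>
     (\<forall>y\<in>ell2. T y \<in> ell2) \<and>
     (\<forall>y\<in>ell2. \<forall>z\<in>ell2. T (\<lambda>n. y n + z n) = (\<lambda>n. T y n + T z n)) \<and>
     (\<forall>c. \<forall>y\<in>ell2. T (\<lambda>n. c *s y n) = (\<lambda>n. c *s T y n)) \<and>
     (\<exists>C. \<forall>y\<in>ell2. ell2_norm (T y) \<le> C * ell2_norm y)"

definition spectrum :: "((int \<Rightarrow> complex ^ 'm) \<Rightarrow> int \<Rightarrow> complex ^ 'm) \<Rightarrow> complex set" where
  "spectrum T = {z. \<not> (\<exists>R. bounded_operator R \<and>
     (\<forall>y\<in>ell2. R (\<lambda>n. T y n - z *s y n) = y) \<and>
     (\<forall>y\<in>ell2. (\<lambda>n. T (R y) n - z *s R y n) = y))}"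

subsection \<open>Complex matrices\<close>

definition conj_transpose :: "complex ^ 'n ^ 'm \<Rightarrow> complex ^ 'm ^ 'n" where
  "conj_transpose A = (\<chi> i j. cnj (A $ j $ i))"

definition pos_semidef :: "complex ^ 'm ^ 'm \<Rightarrow> bool" where
  "pos_semidef A \<longleftrightarrow> conj_transpose A = A \<and>
     (\<forall>x. 0 \<le> Re (\<Sum>i\<in>UNIV. cnj (x $ i) * (A *v x) $ i))"

text \<open>Every positive semidefinite matrix has exactly one positive semidefinite square root;
  for other matrices the value is unspecified.\<close>

definition psd_sqrt :: "complex ^ 'm ^ 'm \<Rightarrow> complex ^ 'm ^ 'm" where
  "psd_sqrt A = (THE B. pos_semidef B \<and> B ** B = A)"

subsection \<open>The Jacobi operator\<close>

definition jacobi_operator ::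
  "(int \<Rightarrow> complex ^ 'm ^ 'm) \<Rightarrow> (int \<Rightarrow> complex ^ 'm ^ 'm) \<Rightarrow>
   (int \<Rightarrow> complex ^ 'm) \<Rightarrow> int \<Rightarrow> complex ^ 'm" where
  "jacobi_operator a b y n =
     conj_transpose (a (n - 1)) *v y (n - 1) + b n *v y n + a n *v y (n + 1)"

end

theory Submission
  imports Defs "HOL-Computational_Algebra.Fundamental_Theorem_Algebra"
begin

text \<open>
  Cut the lattice into periods at a site \<open>n0\<close> where the trace is minimal. The coupling across a cut is
  bounded above and below by \<open>D\<close> and \<open>-D\<close>, where \<open>D\<close> acts within single periods and has trace
  \<open>2 Tr |a n0|\<close> per period. Hence the operator lies between two orthogonal sums of copies of Hermitian
  matrices \<open>L \<le> U\<close> with \<open>Tr (U - L) = 4 Tr |a n0|\<close>. If a real \<open>x\<close> is no eigenvalue of \<open>L\<close> or \<open>U\<close> and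
  both have equally many eigenvalues below \<open>x\<close>, then each period splits as \<open>E \<oplus> F\<close> where \<open>U < x\<close> on \<open>E\<close>
  and \<open>L > x\<close> on \<open>F\<close>; with \<open>S = -1\<close> on \<open>E\<close> and \<open>S = 1\<close> on \<open>F\<close> the form \<open>Re \<langle>(J - x) u, S u\<rangle>\<close>
  is coercive, so \<open>x\<close> is in the resolvent set. Therefore the spectrum has measure at most the integral of
  the difference of the two eigenvalue counting functions, which is \<open>Tr (U - L)\<close>. This replaces the
  Floquet decomposition.
\<close>

subsection \<open>Linear algebra over a finite index set\<close>

text \<open>The form of \<open>J - x\<close> is in general indefinite inside a gap, so it is not
  coercive itself; \<open>S\<close> repairs the sign. Since \<open>E\<close> comes from
  \<open>U\<close> and \<open>F\<close> from \<open>L\<close>, the splitting need not be orthogonal,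
  \<open>S\<close> need not be self-adjoint, and the preconditioner applied to \<open>J - x\<close>
  is the adjoint of \<open>S\<close>. The obstacle is that \<open>S\<close> acts inside each period
  while \<open>J\<close> couples neighbours: a single period also contributes products of an
  \<open>E\<close> component with an \<open>F\<close> component of its neighbour, which have no
  sign. They cancel only between adjacent periods, so the estimate for one period carries boundary
  terms, and coercivity appears after summation over all periods. The matrix \<open>D\<close> has
  its source in the singular values of \<open>a n0\<close>: \<open>2 |Re <a w, u>|\<close> is at
  most \<open><|a| w, w> + <|a^*| u, u>\<close>, and \<open>|a|\<close> and \<open>|a^*|\<close>
  have the same trace. One of them sits on the first site of each period and the other on the last,
  whence the trace of \<open>D\<close>. Coercivity becomes invertibility through a contraction, so
  completeness of \<open>ell2\<close> suffices and no theory of self-adjoint operators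
  enters.\<close>

lemma underdetermined_system:
  fixes c :: "'i \<Rightarrow> 'k \<Rightarrow> 'a :: field"
  assumes "finite I" "finite K" "card I < card K"
  shows "\<exists>z. (\<exists>k\<in>K. z k \<noteq> 0) \<and> (\<forall>i\<in>I. (\<Sum>k\<in>K. c i k * z k) = 0)"
  using assms
proof (induction I arbitrary: K c rule: finite_induct)
  case empty
  then have "K \<noteq> {}" by auto
  then show ?case by (intro exI[of _ "\<lambda>_. 1"]) auto
next
  case (insert i I)
  show ?case
  proof (cases "\<forall>k\<in>K. c i k = 0")
    case True
    have "card I < card K" using insert by auto
    from insert.IH[OF insert.prems(1) this, of c] True show ?thesis by auto
  next
    case False
    then obtain k0 where k0: "k0 \<in> K" "c i k0 \<noteq> 0" by auto
    define K' where "K' = K - {k0}"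
    have K': "finite K'" "K = insert k0 K'" "k0 \<notin> K'" using k0 insert.prems by (auto simp: K'_def)
    then have "card I < card K'" using insert by auto
    \<comment> \<open>Gaussian elimination: equation \<open>i\<close> is solved for the unknown
      \<open>k0\<close>, and substituting the result into equation \<open>j\<close> produces these
      coefficients.\<close>
    from insert.IH[OF K'(1) this, of "\<lambda>j k. c j k - c j k0 * c i k / c i k0"]
    obtain z where z: "\<exists>k\<in>K'. z k \<noteq> 0"
      "\<And>j. j \<in> I \<Longrightarrow> (\<Sum>k\<in>K'. (c j k - c j k0 * c i k / c i k0) * z k) = 0" by auto
    define s where "s = (\<Sum>k\<in>K'. c i k * z k)"
    define z' where "z' = z(k0 := - s / c i k0)"
    have eq: "(\<Sum>k\<in>K. c j k * z' k) = c j k0 * (- s / c i k0) + (\<Sum>k\<in>K'. c j k * z k)" for j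
    proof -
      have "(\<Sum>k\<in>K'. c j k * z' k) = (\<Sum>k\<in>K'. c j k * z k)"
        using K' by (intro sum.cong) (auto simp: z'_def)
      then show ?thesis using K' by (simp add: z'_def)
    qed
    have "(\<Sum>k\<in>K. c j k * z' k) = 0" if "j \<in> insert i I" for j
    proof (cases "j = i")
      case True
      then show ?thesis using eq[of i] k0 by (simp add: s_def)
    next
      case False
      then have "0 = (\<Sum>k\<in>K'. c j k * z k - c j k0 / c i k0 * (c i k * z k))"
        using z(2)[of j] that by (simp add: algebra_simps)
      also have "\<dots> = (\<Sum>k\<in>K'. c j k * z k) - c j k0 / c i k0 * s"
        by (simp add: sum_subtractf s_def sum_distrib_left)
      finally show ?thesis unfolding eq by simp
    qed
    moreover have "\<exists>k\<in>K. z' k \<noteq> 0" using z(1) K' by (auto simp: z'_def)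
    ultimately show ?thesis by blast
  qed
qed

text \<open>Counting unknowns replaces determinants: a right inverse arises column by column from a
  system with one extra unknown, and it is also a left inverse because
  \<open>c (b c - 1) = 0\<close> and the kernel is trivial. Rows and columns have separate index
  sets since later the columns are two families of eigenvectors joined in a disjoint sum.\<close>

lemma trivial_kernel_imp_inverse:
  fixes c :: "'i \<Rightarrow> 'k \<Rightarrow> 'a :: field"
  assumes fin: "finite I" "finite K" "card I = card K"
    and ker: "\<And>z. (\<And>i. i \<in> I \<Longrightarrow> (\<Sum>k\<in>K. c i k * z k) = 0) \<Longrightarrow> \<forall>k\<in>K. z k = 0"
  obtains b where
    "\<And>i j. i \<in> I \<Longrightarrow> j \<in> I \<Longrightarrow> (\<Sum>k\<in>K. c i k * b k j) = of_bool (i = j)"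
    "\<And>k l. k \<in> K \<Longrightarrow> l \<in> K \<Longrightarrow> (\<Sum>i\<in>I. b k i * c i l) = of_bool (k = l)"
proof -
  have "\<exists>w. \<forall>i\<in>I. (\<Sum>k\<in>K. c i k * w k) = of_bool (i = j)" for j
  proof -
    \<comment> \<open>The unknown \<open>None\<close> multiplies minus the \<open>j\<close>-th unit
      vector. A nonzero solution with \<open>z None = 0\<close> would give a nonzero kernel vector
      of \<open>c\<close>, so dividing by \<open>z None\<close> is possible and solves the
      inhomogeneous system.\<close>
    define c' where "c' i k = (case k of None \<Rightarrow> - of_bool (i = j) | Some k \<Rightarrow> c i k)" for i k
    define K' where "K' = insert None (Some ` K)"
    have sum: "(\<Sum>k\<in>K'. c' i k * z k) = - of_bool (i = j) * z None + (\<Sum>k\<in>K. c i k * z (Some k))" for i z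
      using fin by (simp add: K'_def c'_def sum.reindex)
    have "finite K'" "card I < card K'" using fin by (auto simp: K'_def card_image)
    from underdetermined_system[OF fin(1) this, of c'] obtain z where
      z: "\<exists>k\<in>K'. z k \<noteq> 0" "\<And>i. i \<in> I \<Longrightarrow> (\<Sum>k\<in>K'. c' i k * z k) = 0" by auto
    have "z None \<noteq> 0"
    proof
      assume 0: "z None = 0"
      then have "\<forall>k\<in>K. z (Some k) = 0" using z(2) sum by (intro ker) auto
      with 0 z(1) show False by (auto simp: K'_def)
    qed
    then have "(\<Sum>k\<in>K. c i k * (z (Some k) / z None)) = of_bool (i = j)" if "i \<in> I" for i
      using z(2)[OF that] unfolding sum
      by (auto simp flip: sum_divide_distrib simp: field_simps)
    then show ?thesis by (intro exI[of _ "\<lambda>k. z (Some k) / z None"]) auto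
  qed
  then obtain w where w: "\<And>i j. i \<in> I \<Longrightarrow> (\<Sum>k\<in>K. c i k * w j k) = of_bool (i = j)"
    by metis
  have "(\<Sum>i\<in>I. w i k * c i l) = of_bool (k = l)" if kl: "k \<in> K" "l \<in> K" for k l
  proof -
    have "\<forall>k\<in>K. (\<Sum>j\<in>I. w j k * c j l) - of_bool (k = l) = 0"
    proof (rule ker)
      fix i assume i: "i \<in> I"
      have "(\<Sum>k\<in>K. c i k * (\<Sum>j\<in>I. w j k * c j l)) = (\<Sum>j\<in>I. (\<Sum>k\<in>K. c i k * w j k) * c j l)"
        by (simp add: sum_distrib_left sum_distrib_right mult.assoc) (rule sum.swap)
      also have "\<dots> = c i l" using w[OF i] i fin by (simp add: of_bool_def if_distrib[of "\<lambda>x. x * _"] sum.delta' cong: if_cong)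
      finally show "(\<Sum>k\<in>K. c i k * ((\<Sum>j\<in>I. w j k * c j l) - of_bool (k = l))) = 0"
        using kl fin by (simp add: right_diff_distrib sum_subtractf of_bool_def if_distrib[of "\<lambda>x. _ * x"] sum.delta' cong: if_cong)
    qed
    then show ?thesis using kl by auto
  qed
  with w show ?thesis by (intro that[of "\<lambda>k j. w j k"]) auto
qed

text \<open>Vectors are total functions of which only the values on \<open>I\<close> count. Explicit
  index sets are used because the coordinates of one period form a set that depends on the variable
  \<open>p\<close>.\<close>

definition matvec :: "'i set \<Rightarrow> ('i \<Rightarrow> 'i \<Rightarrow> complex) \<Rightarrow> ('i \<Rightarrow> complex) \<Rightarrow> 'i \<Rightarrow> complex" where
  "matvec I M u i = (\<Sum>j\<in>I. M i j * u j)"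

definition inner_on :: "'i set \<Rightarrow> ('i \<Rightarrow> complex) \<Rightarrow> ('i \<Rightarrow> complex) \<Rightarrow> complex" where
  "inner_on I u v = (\<Sum>i\<in>I. u i * cnj (v i))"

definition normsq :: "'i set \<Rightarrow> ('i \<Rightarrow> complex) \<Rightarrow> real" where
  "normsq I u = (\<Sum>i\<in>I. (cmod (u i))\<^sup>2)"

definition hermitian_on :: "'i set \<Rightarrow> ('i \<Rightarrow> 'i \<Rightarrow> complex) \<Rightarrow> bool" where
  "hermitian_on I M \<longleftrightarrow> (\<forall>i\<in>I. \<forall>j\<in>I. M j i = cnj (M i j))"

lemma inner_on_self: "inner_on I u u = of_real (normsq I u)"
  by (simp add: inner_on_def normsq_def complex_norm_square del: of_real_power)

lemma normsq_nonneg [simp]: "0 \<le> normsq I u"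
  by (simp add: normsq_def sum_nonneg)

lemma normsq_eq_0_iff: "finite I \<Longrightarrow> normsq I u = 0 \<longleftrightarrow> (\<forall>i\<in>I. u i = 0)"
  by (simp add: normsq_def sum_nonneg_eq_0_iff)

lemma normsq_pos: "finite I \<Longrightarrow> i \<in> I \<Longrightarrow> u i \<noteq> 0 \<Longrightarrow> 0 < normsq I u"
  using normsq_eq_0_iff[of I u] normsq_nonneg[of I u] by (metis less_eq_real_def)

lemma inner_on_cong: "(\<And>i. i \<in> I \<Longrightarrow> u i = u' i) \<Longrightarrow> (\<And>i. i \<in> I \<Longrightarrow> v i = v' i) \<Longrightarrow> inner_on I u v = inner_on I u' v'"
  by (simp add: inner_on_def)

lemma matvec_cong: "(\<And>i. i \<in> I \<Longrightarrow> u i = u' i) \<Longrightarrow> matvec I M u = matvec I M u'"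
  by (simp add: matvec_def fun_eq_iff)

lemma normsq_cong: "(\<And>i. i \<in> I \<Longrightarrow> u i = u' i) \<Longrightarrow> normsq I u = normsq I u'"
  by (simp add: normsq_def)

lemma inner_on_commute: "inner_on I u v = cnj (inner_on I v u)"
  by (simp add: inner_on_def mult.commute)

lemma inner_on_lincomb_left: "inner_on I (\<lambda>i. \<Sum>k\<in>K. c k * u k i) v = (\<Sum>k\<in>K. c k * inner_on I (u k) v)"
  unfolding inner_on_def sum_distrib_left sum_distrib_right
  by (subst sum.swap) (simp add: mult.assoc)

lemma inner_on_lincomb_right: "inner_on I u (\<lambda>i. \<Sum>k\<in>K. c k * v k i) = (\<Sum>k\<in>K. cnj (c k) * inner_on I u (v k))"
  unfolding inner_on_def cnj_sum sum_distrib_left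
  by (subst sum.swap) (simp add: mult_ac)

lemma inner_on_scale_left: "inner_on I (\<lambda>i. c * u i) v = c * inner_on I u v"
  by (simp add: inner_on_def sum_distrib_left mult.assoc)

lemma inner_on_scale_right: "inner_on I u (\<lambda>i. c * v i) = cnj c * inner_on I u v"
  by (simp add: inner_on_def sum_distrib_left mult_ac)

lemma inner_on_add_left: "inner_on I (\<lambda>i. u i + u' i) v = inner_on I u v + inner_on I u' v"
  by (simp add: inner_on_def algebra_simps sum.distrib)

lemma inner_on_add_right: "inner_on I v (\<lambda>i. u i + u' i) = inner_on I v u + inner_on I v u'"
  by (simp add: inner_on_def algebra_simps sum.distrib)

lemma inner_on_diff_left: "inner_on I (\<lambda>i. u i - u' i) v = inner_on I u v - inner_on I u' v"
  by (simp add: inner_on_def algebra_simps sum_subtractf)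

lemma inner_on_diff_right: "inner_on I v (\<lambda>i. u i - u' i) = inner_on I v u - inner_on I v u'"
  by (simp add: inner_on_def algebra_simps sum_subtractf)

lemma matvec_lincomb: "matvec I M (\<lambda>i. \<Sum>k\<in>K. c k * u k i) i = (\<Sum>k\<in>K. c k * matvec I M (u k) i)"
  unfolding matvec_def sum_distrib_left
  by (subst sum.swap) (simp add: mult_ac)

lemma matvec_scale: "matvec I M (\<lambda>i. c * u i) = (\<lambda>i. c * matvec I M u i)"
  by (simp add: matvec_def sum_distrib_left mult_ac fun_eq_iff)

lemma matvec_add: "matvec I M (\<lambda>i. u i + v i) = (\<lambda>i. matvec I M u i + matvec I M v i)"
  by (simp add: matvec_def algebra_simps sum.distrib fun_eq_iff)

lemma matvec_diff: "matvec I M (\<lambda>i. u i - v i) = (\<lambda>i. matvec I M u i - matvec I M v i)"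
  by (simp add: matvec_def algebra_simps sum_subtractf fun_eq_iff)

lemma inner_on_matvec_adjoint: "inner_on I (matvec I M u) v = inner_on I u (matvec I (\<lambda>i j. cnj (M j i)) v)"
  unfolding inner_on_def matvec_def cnj_sum sum_distrib_left sum_distrib_right
  by (subst sum.swap) (simp add: mult_ac)

lemma inner_on_matvec_hermitian:
  assumes "hermitian_on I M"
  shows "inner_on I (matvec I M u) v = inner_on I u (matvec I M v)"
proof -
  have "matvec I (\<lambda>i j. cnj (M j i)) v i = matvec I M v i" if "i \<in> I" for i
    unfolding matvec_def using assms that
    by (intro sum.cong refl) (metis hermitian_on_def)
  then show ?thesis unfolding inner_on_matvec_adjoint by (intro inner_on_cong) auto
qed

section \<open>The spectral theorem for Hermitian matrices\<close>

lemma hermitian_eigenvalue_real: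
  assumes "finite I" "hermitian_on I M" "\<And>i. i \<in> I \<Longrightarrow> matvec I M u i = l * u i" "\<exists>i\<in>I. u i \<noteq> 0"
  shows "l = of_real (Re l)"
proof -
  have "l * inner_on I u u = inner_on I (matvec I M u) u"
    unfolding inner_on_scale_left[symmetric] using assms(3) by (intro inner_on_cong) auto
  also have "\<dots> = inner_on I u (matvec I M u)" using assms inner_on_matvec_hermitian by blast
  also have "\<dots> = cnj l * inner_on I u u"
    unfolding inner_on_scale_right[symmetric] using assms(3) by (intro inner_on_cong) auto
  finally have "l = cnj l" using normsq_eq_0_iff[of I u] assms(1,4) by (auto simp: inner_on_self)
  then show ?thesis by (simp add: complex_eq_iff)
qed

text \<open>The vector is found in the Krylov space of some \<open>u\<close> orthogonal to all \<open>V k\<close>: if \<open>q\<close> is of least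
  degree among the nonzero polynomials with \<open>q(M) u = 0\<close> and \<open>r\<close> is a root of \<open>q\<close>, then \<open>(q / (X - r))(M) u\<close>
  is an eigenvector.\<close>

lemma hermitian_eigenvector_orthogonal:
  fixes V :: "'k \<Rightarrow> 'i \<Rightarrow> complex" and d :: "'k \<Rightarrow> real"
  assumes fin: "finite I" "finite K" "card K < card I" and M: "hermitian_on I M"
    and V: "\<And>k i. k \<in> K \<Longrightarrow> i \<in> I \<Longrightarrow> matvec I M (V k) i = d k * V k i"
  obtains u l where "\<exists>i\<in>I. u i \<noteq> 0" "\<And>k. k \<in> K \<Longrightarrow> inner_on I u (V k) = 0"
    "\<And>i. i \<in> I \<Longrightarrow> matvec I M u i = l * u i"
proof -
  from underdetermined_system[OF fin(2,1,3), of "\<lambda>k i. cnj (V k i)"]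
  obtain u where u: "\<exists>i\<in>I. u i \<noteq> 0" "\<And>k. k \<in> K \<Longrightarrow> inner_on I u (V k) = 0"
    by (auto simp: inner_on_def mult.commute)
  define P where "P j = (matvec I M ^^ j) u" for j :: nat
  have P_Suc: "P (Suc j) = matvec I M (P j)" for j by (simp add: P_def)
  \<comment> \<open>Each \<open>V k\<close> is an eigenvector and \<open>M\<close> is Hermitian, so
    the orthogonal complement of the \<open>V k\<close> is mapped to itself.\<close>
  have P_orth: "inner_on I (P j) (V k) = 0" if "k \<in> K" for j k
  proof (induction j)
    case 0
    then show ?case using u that by (simp add: P_def)
  next
    case (Suc j)
    have "inner_on I (P (Suc j)) (V k) = inner_on I (P j) (matvec I M (V k))"
      unfolding P_Suc by (rule inner_on_matvec_hermitian[OF M])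
    also have "\<dots> = inner_on I (P j) (\<lambda>i. d k * V k i)" using V that by (intro inner_on_cong) auto
    finally show ?case using Suc by (simp add: inner_on_scale_right)
  qed
  define ap where "ap n q i = (\<Sum>j\<le>n. coeff q j * P j i)" for n and q :: "complex poly" and i
  \<comment> \<open>\<open>ap n q\<close> is \<open>q(M) u\<close> as soon as \<open>n\<close>
    reaches the degree of \<open>q\<close>. Raising \<open>n\<close> further changes nothing, which
    lets \<open>q\<close> and its quotient \<open>q'\<close> be summed over one range below.\<close>
  have ap_cong: "ap n q i = ap m q i" if "degree q \<le> m" "m \<le> n" for n m q i
    unfolding ap_def using that by (intro sum.mono_neutral_right) (auto simp: coeff_eq_0)
  define ann where "ann q \<longleftrightarrow> q \<noteq> 0 \<and> (\<forall>i\<in>I. ap (degree q) q i = 0)" for q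
  \<comment> \<open>\<open>card I + 1\<close> Krylov vectors in \<open>card I\<close> coordinates
    are linearly dependent; this yields a nonzero annihilating polynomial.\<close>
  have "finite {..card I}" "card I < card {..card I}" by auto
  from underdetermined_system[OF fin(1) this, of "\<lambda>i j. P j i"]
  obtain z where z: "\<exists>j\<le>card I. z j \<noteq> 0" "\<And>i. i \<in> I \<Longrightarrow> (\<Sum>j\<le>card I. P j i * z j) = 0" by auto
  define q0 where "q0 = (\<Sum>j\<le>card I. monom (z j) j)"
  have cq0: "coeff q0 j = (if j \<le> card I then z j else 0)" for j
    by (simp add: q0_def coeff_sum sum.delta' if_distrib cong: if_cong)
  have "degree q0 \<le> card I" by (intro degree_le) (simp add: cq0)
  moreover have "q0 \<noteq> 0" using z(1) cq0 by (metis coeff_0)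
  moreover have "ap (card I) q0 i = 0" if "i \<in> I" for i
    using z(2)[OF that] by (simp add: ap_def cq0 mult.commute)
  ultimately have "ann q0" using ap_cong[of q0 "degree q0" "card I"] by (auto simp: ann_def)
  then obtain q where q: "ann q" "\<And>q'. ann q' \<Longrightarrow> degree q \<le> degree q'"
    using ex_has_least_nat[of ann q0 degree] by blast
  have "degree q \<noteq> 0"
  proof
    assume "degree q = 0"
    then obtain c where "q = [:c:]" using degree_eq_zeroE by blast
    with q(1) u(1) show False by (auto simp: ann_def ap_def P_def)
  qed
  then obtain r where "poly q r = 0"
    using fundamental_theorem_of_algebra[of q] by (metis constant_degree)
  then obtain q' where q': "q = [:- r, 1:] * q'" by (metis poly_eq_0_iff_dvd dvdE)
  have q'0: "q' \<noteq> 0" using q(1) q' by (auto simp: ann_def)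
  then have deg: "degree q = Suc (degree q')" unfolding q' by (subst degree_mult_eq) auto
  define w where "w = ap (degree q') q'"
  have "\<exists>i\<in>I. w i \<noteq> 0"
    using q(2)[of q'] q'0 deg by (auto simp: ann_def w_def)
  moreover have "inner_on I w (V k) = 0" if "k \<in> K" for k
    unfolding w_def ap_def[abs_def] inner_on_lincomb_left using P_orth that by simp
  moreover have "matvec I M w i = r * w i" if "i \<in> I" for i
  proof -
    let ?n = "degree q'"
    have "0 = ap (Suc ?n) q i" using q(1) that deg by (simp add: ann_def)
    also have "\<dots> = (\<Sum>j\<le>Suc ?n. coeff (pCons 0 q') j * P j i) - (\<Sum>j\<le>Suc ?n. r * coeff q' j * P j i)"
      unfolding ap_def q' sum_subtractf[symmetric] by (intro sum.cong) (auto simp: algebra_simps)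
    also have "(\<Sum>j\<le>Suc ?n. coeff (pCons 0 q') j * P j i) = (\<Sum>j\<le>?n. coeff q' j * P (Suc j) i)"
      by (subst sum.atMost_Suc_shift) simp
    also have "\<dots> = matvec I M w i"
      unfolding w_def ap_def[abs_def] matvec_lincomb P_Suc ..
    also have "(\<Sum>j\<le>Suc ?n. r * coeff q' j * P j i) = r * ap (Suc ?n) q' i"
      by (simp only: ap_def sum_distrib_left mult.assoc)
    also have "ap (Suc ?n) q' i = w i" unfolding w_def by (rule ap_cong) auto
    finally show ?thesis by simp
  qed
  ultimately show ?thesis using that by blast
qed

text \<open>Eigenvectors are added one by one in the orthogonal complement of those already found.
  Labelling them by the coordinates themselves makes their number \<open>card I\<close>. The third
  property is completeness: a square matrix with orthonormal columns is invertible, and its inverse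
  is the conjugate transpose.\<close>

theorem hermitian_spectral:
  assumes fin: "finite I" and M: "hermitian_on I M"
  obtains V :: "'i \<Rightarrow> 'i \<Rightarrow> complex" and d :: "'i \<Rightarrow> real" where
    "\<And>k l. k \<in> I \<Longrightarrow> l \<in> I \<Longrightarrow> inner_on I (V k) (V l) = of_bool (k = l)"
    "\<And>k i. k \<in> I \<Longrightarrow> i \<in> I \<Longrightarrow> matvec I M (V k) i = d k * V k i"
    "\<And>i j. i \<in> I \<Longrightarrow> j \<in> I \<Longrightarrow> (\<Sum>k\<in>I. V k i * cnj (V k j)) = of_bool (i = j)"
proof -
  have "\<exists>V d. (\<forall>k\<in>K. \<forall>l\<in>K. inner_on I (V k) (V l) = of_bool (k = l)) \<and>
      (\<forall>k\<in>K. \<forall>i\<in>I. matvec I M (V k) i = complex_of_real (d k) * V k i)" if "K \<subseteq> I" for K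
    using finite_subset[OF that fin] that
  proof (induction K rule: finite_induct)
    case empty
    then show ?case by simp
  next
    case (insert k0 K)
    have "K \<subseteq> I" using insert.prems by auto
    from insert.IH[OF this] obtain V :: "'i \<Rightarrow> 'i \<Rightarrow> complex" and d :: "'i \<Rightarrow> real" where
      VV: "(\<forall>k\<in>K. \<forall>l\<in>K. inner_on I (V k) (V l) = of_bool (k = l)) \<and>
        (\<forall>k\<in>K. \<forall>i\<in>I. matvec I M (V k) i = complex_of_real (d k) * V k i)" by (elim exE)
    note V = conjunct1[OF VV, rule_format] conjunct2[OF VV, rule_format]
    have "card K < card I"
      using insert by (intro psubset_card_mono[OF fin]) auto
    then obtain u l where u: "\<exists>i\<in>I. u i \<noteq> 0" "\<And>k. k \<in> K \<Longrightarrow> inner_on I u (V k) = 0"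
      "\<And>i. i \<in> I \<Longrightarrow> matvec I M u i = l * u i"
      by (rule hermitian_eigenvector_orthogonal[OF fin insert(1) _ M, where V = V and d = d])
        (use V(2) that in blast)+
    have l: "l = of_real (Re l)" using hermitian_eigenvalue_real[OF fin M u(3,1)] .
    define s where "s = sqrt (normsq I u)"
    have "normsq I u > 0" using normsq_pos[OF fin] u(1) by blast
    then have s: "s > 0" "s * s = normsq I u" by (auto simp: s_def)
    define v where "v i = inverse (of_real s) * u i" for i
    have "inner_on I v v = inverse (of_real s) * (inverse (of_real s) * of_real (normsq I u))"
      unfolding v_def[abs_def] inner_on_scale_left inner_on_scale_right by (simp add: inner_on_self)
    then have v1: "inner_on I v v = 1" using s(1) by (simp flip: s(2) add: field_simps)
    have v: "inner_on I v (V k) = 0" "inner_on I (V k) v = 0" if "k \<in> K" for k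
      using u(2)[OF that] inner_on_commute[of I "V k" u]
      unfolding v_def[abs_def] inner_on_scale_left inner_on_scale_right by auto
    have v2: "matvec I M v i = of_real (Re l) * v i" if "i \<in> I" for i
      using u(3)[OF that] l unfolding v_def[abs_def] matvec_scale by simp
    show ?case
      using insert(2) V v v1 v2
      by (intro exI[of _ "V(k0 := v)"] exI[of _ "d(k0 := Re l)"]) auto
  qed
  from this[OF order_refl] obtain V :: "'i \<Rightarrow> 'i \<Rightarrow> complex" and d :: "'i \<Rightarrow> real" where
    VV: "(\<forall>k\<in>I. \<forall>l\<in>I. inner_on I (V k) (V l) = of_bool (k = l)) \<and>
      (\<forall>k\<in>I. \<forall>i\<in>I. matvec I M (V k) i = complex_of_real (d k) * V k i)" by (elim exE)
  note V = conjunct1[OF VV, rule_format] conjunct2[OF VV, rule_format]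
  have ker: "\<forall>k\<in>I. z k = 0" if "\<And>i. i \<in> I \<Longrightarrow> (\<Sum>k\<in>I. V k i * z k) = 0" for z
  proof
    fix k assume k: "k \<in> I"
    have "0 = inner_on I (\<lambda>i. \<Sum>k\<in>I. z k * V k i) (V k)"
      using that by (simp add: inner_on_def mult.commute)
    also have "\<dots> = (\<Sum>l\<in>I. z l * of_bool (l = k))"
      unfolding inner_on_lincomb_left using V(1) k by (intro sum.cong) auto
    also have "\<dots> = z k" using k fin by simp
    finally show "z k = 0" by simp
  qed
  obtain b where b: "\<And>i j. i \<in> I \<Longrightarrow> j \<in> I \<Longrightarrow> (\<Sum>k\<in>I. V k i * b k j) = of_bool (i = j)"
    by (rule trivial_kernel_imp_inverse[where c = "\<lambda>i k. V k i", OF fin fin refl ker]) (use that in blast)+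
  \<comment> \<open>Column \<open>j\<close> of \<open>V b = 1\<close>, paired with
    \<open>V k\<close>, leaves \<open>b k j\<close> on one side by orthonormality and
    \<open>cnj (V k j)\<close> on the other.\<close>
  have "b k j = cnj (V k j)" if kj: "k \<in> I" "j \<in> I" for k j
  proof -
    have "cnj (V k j) = (\<Sum>i\<in>I. of_bool (i = j) * cnj (V k i))" using kj fin by simp
    also have "\<dots> = (\<Sum>i\<in>I. (\<Sum>l\<in>I. b l j * V l i) * cnj (V k i))"
      using b kj by (intro sum.cong) (auto simp: mult.commute)
    also have "\<dots> = inner_on I (\<lambda>i. \<Sum>l\<in>I. b l j * V l i) (V k)" by (simp add: inner_on_def)
    also have "\<dots> = (\<Sum>l\<in>I. b l j * of_bool (l = k))"
      unfolding inner_on_lincomb_left using V(1) kj by (intro sum.cong) auto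
    also have "\<dots> = b k j" using kj fin by simp
    finally show ?thesis by simp
  qed
  then have complete: "(\<Sum>k\<in>I. V k i * cnj (V k j)) = of_bool (i = j)" if "i \<in> I" "j \<in> I" for i j
    using b[OF that] that by simp
  show ?thesis by (rule that[of V d]) (simp_all only: V complete)
qed

subsection \<open>Quadratic forms and spectral gaps\<close>

definition quad_form :: "'i set \<Rightarrow> ('i \<Rightarrow> 'i \<Rightarrow> complex) \<Rightarrow> ('i \<Rightarrow> complex) \<Rightarrow> real" where
  "quad_form I M u = Re (inner_on I (matvec I M u) u)"

lemma quad_form_cong: "(\<And>i. i \<in> I \<Longrightarrow> u i = u' i) \<Longrightarrow> quad_form I M u = quad_form I M u'"
  unfolding quad_form_def by (metis (no_types, lifting) inner_on_cong matvec_cong)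

lemma matvec_mat_add: "matvec I (\<lambda>i j. M i j + N i j) u = (\<lambda>i. matvec I M u i + matvec I N u i)"
  by (simp add: matvec_def algebra_simps sum.distrib fun_eq_iff)

lemma matvec_mat_diff: "matvec I (\<lambda>i j. M i j - N i j) u = (\<lambda>i. matvec I M u i - matvec I N u i)"
  by (simp add: matvec_def algebra_simps sum_subtractf fun_eq_iff)

lemma quad_form_mat_add: "quad_form I (\<lambda>i j. M i j + N i j) u = quad_form I M u + quad_form I N u"
  by (simp add: quad_form_def matvec_mat_add inner_on_add_left)

lemma quad_form_mat_diff: "quad_form I (\<lambda>i j. M i j - N i j) u = quad_form I M u - quad_form I N u"
  by (simp add: quad_form_def matvec_mat_diff inner_on_diff_left)

lemma abs_Re_inner_on_le: "\<bar>Re (inner_on I u v)\<bar> \<le> (normsq I u + normsq I v) / 2"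
proof -
  have "cmod (inner_on I u v) \<le> (\<Sum>i\<in>I. cmod (u i * cnj (v i)))"
    unfolding inner_on_def by (rule norm_sum)
  also have "\<dots> \<le> (\<Sum>i\<in>I. ((cmod (u i))\<^sup>2 + (cmod (v i))\<^sup>2) / 2)"
  proof (rule sum_mono)
    fix i
    show "cmod (u i * cnj (v i)) \<le> ((cmod (u i))\<^sup>2 + (cmod (v i))\<^sup>2) / 2"
      using sum_squares_bound[of "cmod (u i)" "cmod (v i)"] by (simp add: norm_mult)
  qed
  also have "\<dots> = (normsq I u + normsq I v) / 2"
    by (simp add: normsq_def sum.distrib flip: sum_divide_distrib)
  finally show ?thesis using abs_Re_le_cmod order_trans by blast
qed

lemma normsq_add_le: "normsq I (\<lambda>i. u i + v i) \<le> 2 * normsq I u + 2 * normsq I v"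
proof -
  have "(cmod (a + b))\<^sup>2 \<le> 2 * (cmod a)\<^sup>2 + 2 * (cmod b)\<^sup>2" for a b :: complex
  proof -
    have "(cmod (a + b))\<^sup>2 \<le> (cmod a + cmod b)\<^sup>2" by (intro power_mono norm_triangle_ineq) auto
    also have "\<dots> \<le> 2 * (cmod a)\<^sup>2 + 2 * (cmod b)\<^sup>2"
      using sum_squares_bound[of "cmod a" "cmod b"] by (simp add: power2_sum)
    finally show ?thesis .
  qed
  then show ?thesis unfolding normsq_def sum_distrib_left sum.distrib[symmetric] by (intro sum_mono) auto
qed

lemma normsq_scale: "normsq I (\<lambda>i. c * u i) = (cmod c)\<^sup>2 * normsq I u"
  by (simp add: normsq_def norm_mult power_mult_distrib sum_distrib_left)

lemma normsq_diff_le: "normsq I (\<lambda>i. u i - v i) \<le> 2 * normsq I u + 2 * normsq I v"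
  using normsq_add_le[of I u "\<lambda>i. - v i"] by (simp add: normsq_def)

lemma normsq_matvec_bounded: "\<exists>C\<ge>0. \<forall>u. normsq I (matvec I M u) \<le> C * normsq I u"
proof -
  \<comment> \<open>The squared Frobenius norm, reached by Cauchy-Schwarz in every row.\<close>
  define C where "C = (\<Sum>i\<in>I. \<Sum>j\<in>I. (cmod (M i j))\<^sup>2)"
  have "normsq I (matvec I M u) \<le> C * normsq I u" for u
  proof -
    have "(cmod (matvec I M u i))\<^sup>2 \<le> (\<Sum>j\<in>I. (cmod (M i j))\<^sup>2) * normsq I u" for i
    proof -
      have "cmod (matvec I M u i) \<le> (\<Sum>j\<in>I. \<bar>cmod (M i j)\<bar> * \<bar>cmod (u j)\<bar>)"
        unfolding matvec_def by (rule order_trans[OF norm_sum]) (simp add: norm_mult)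
      also have "\<dots> \<le> L2_set (\<lambda>j. cmod (M i j)) I * L2_set (\<lambda>j. cmod (u j)) I"
        by (rule L2_set_mult_ineq)
      finally have "(cmod (matvec I M u i))\<^sup>2 \<le> (L2_set (\<lambda>j. cmod (M i j)) I * L2_set (\<lambda>j. cmod (u j)) I)\<^sup>2"
        by (intro power_mono) auto
      then show ?thesis by (simp add: power_mult_distrib L2_set_def normsq_def sum_nonneg)
    qed
    then show ?thesis unfolding normsq_def[of I "matvec I M u"] C_def sum_distrib_right by (intro sum_mono) auto
  qed
  moreover have "C \<ge> 0" by (simp add: C_def sum_nonneg)
  ultimately show ?thesis by blast
qed

section \<open>Two ordered Hermitian matrices compared at a level \<open>x\<close>\<close>

lemma orthonormal_eigen_lincomb:
  fixes V :: "'k \<Rightarrow> 'i \<Rightarrow> complex" and d :: "'k \<Rightarrow> real"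
  assumes fin: "finite K"
    and orth: "\<And>k l. k \<in> K \<Longrightarrow> l \<in> K \<Longrightarrow> inner_on I (V k) (V l) = of_bool (k = l)"
    and eig: "\<And>k i. k \<in> K \<Longrightarrow> i \<in> I \<Longrightarrow> matvec I M (V k) i = d k * V k i"
  shows "normsq I (\<lambda>i. \<Sum>k\<in>K. z k * V k i) = (\<Sum>k\<in>K. (cmod (z k))\<^sup>2)" (is "normsq I ?u = _")
    and "quad_form I M (\<lambda>i. \<Sum>k\<in>K. z k * V k i) = (\<Sum>k\<in>K. d k * (cmod (z k))\<^sup>2)"
proof -
  have V: "inner_on I (V k) ?u = cnj (z k)" if "k \<in> K" for k
  proof -
    have "inner_on I (V k) ?u = (\<Sum>l\<in>K. cnj (z l) * of_bool (k = l))"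
      unfolding inner_on_lincomb_right using orth that by (intro sum.cong) auto
    also have "\<dots> = cnj (z k)" using fin that by simp
    finally show ?thesis .
  qed
  have "complex_of_real (normsq I ?u) = (\<Sum>k\<in>K. z k * cnj (z k))"
    unfolding inner_on_self[symmetric] inner_on_lincomb_left using V by simp
  also have "\<dots> = complex_of_real (\<Sum>k\<in>K. (cmod (z k))\<^sup>2)"
    by (simp add: complex_norm_square del: of_real_power)
  finally show "normsq I ?u = (\<Sum>k\<in>K. (cmod (z k))\<^sup>2)" by (simp only: of_real_eq_iff)
  have "inner_on I (matvec I M ?u) ?u = inner_on I (\<lambda>i. \<Sum>k\<in>K. (z k * d k) * V k i) ?u"
    unfolding matvec_lincomb[abs_def] using eig by (intro inner_on_cong) (auto intro!: sum.cong)
  also have "\<dots> = (\<Sum>k\<in>K. d k * (z k * cnj (z k)))"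
    unfolding inner_on_lincomb_left using V by (intro sum.cong) auto
  also have "\<dots> = complex_of_real (\<Sum>k\<in>K. d k * (cmod (z k))\<^sup>2)"
    by (simp add: complex_norm_square del: of_real_power)
  finally show "quad_form I M ?u = (\<Sum>k\<in>K. d k * (cmod (z k))\<^sup>2)"
    unfolding quad_form_def by (simp only: Re_complex_of_real)
qed

text \<open>Let E be spanned by the \<open>V' k\<close> with \<open>d' k < x\<close> and F by the
  \<open>V k\<close> with \<open>d k > x\<close>. On a common vector the form of \<open>M\<close>
  would be at least \<open>x + \<delta>\<close> and that of \<open>M'\<close> at most
  \<open>x - \<delta>\<close> times the squared norm, against \<open>le\<close>. So E and F meet
  only in 0 and their dimensions add up to at most \<open>card I\<close>, which is the inequality of
  counts. Equal counts make E and F complementary.\<close>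

lemma
  fixes V V' :: "'i \<Rightarrow> 'i \<Rightarrow> complex" and d d' :: "'i \<Rightarrow> real"
  assumes fin: "finite I"
    and orth: "\<And>k l. k \<in> I \<Longrightarrow> l \<in> I \<Longrightarrow> inner_on I (V k) (V l) = of_bool (k = l)"
    and eig: "\<And>k i. k \<in> I \<Longrightarrow> i \<in> I \<Longrightarrow> matvec I M (V k) i = d k * V k i"
    and orth': "\<And>k l. k \<in> I \<Longrightarrow> l \<in> I \<Longrightarrow> inner_on I (V' k) (V' l) = of_bool (k = l)"
    and eig': "\<And>k i. k \<in> I \<Longrightarrow> i \<in> I \<Longrightarrow> matvec I M' (V' k) i = d' k * V' k i"
    and le: "\<And>u. quad_form I M u \<le> quad_form I M' u"
    and x: "\<And>k. k \<in> I \<Longrightarrow> d k \<noteq> x \<and> d' k \<noteq> x"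
  shows eigenvalue_count_le: "card {k\<in>I. d' k < x} \<le> card {k\<in>I. d k < x}"
    and eigenvalue_gap_splitting: "card {k\<in>I. d' k < x} = card {k\<in>I. d k < x} \<Longrightarrow>
      \<exists>S \<delta>. \<delta> > 0 \<and> (\<forall>u. \<exists>e f. (\<forall>i\<in>I. u i = e i + f i \<and> matvec I S u i = f i - e i) \<and>
        quad_form I M' e \<le> (x - \<delta>) * normsq I e \<and> (x + \<delta>) * normsq I f \<le> quad_form I M f)"
proof -
  \<comment> \<open>The distances of \<open>x\<close> from all eigenvalues; the 1 keeps the set
    nonempty if \<open>I\<close> is empty.\<close>
  define D where "D = insert 1 ((\<lambda>k. \<bar>d k - x\<bar>) ` I \<union> (\<lambda>k. \<bar>d' k - x\<bar>) ` I)"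
  define \<delta> where "\<delta> = Min D"
  have D: "finite D" "D \<noteq> {}" using fin by (auto simp: D_def)
  have "0 < y" if "y \<in> D" for y using x that by (auto simp: D_def)
  then have \<delta>: "\<delta> > 0" using D by (simp add: \<delta>_def)
  have d_le: "\<delta> \<le> \<bar>d k - x\<bar>" "\<delta> \<le> \<bar>d' k - x\<bar>" if "k \<in> I" for k
    using D that unfolding \<delta>_def by (auto intro!: Min_le simp: D_def)
  define K1 where "K1 = {k\<in>I. d' k < x}"
  define K2 where "K2 = {k\<in>I. x < d k}"
  have fK: "finite K1" "finite K2" using fin by (auto simp: K1_def K2_def)
  have "{k\<in>I. d k < x} = I - K2" using x by (auto simp: K2_def) (meson linorder_neqE)
  then have card2: "card {k\<in>I. d k < x} = card I - card K2"
    using fK by (simp add: card_Diff_subset K2_def)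
  have le2: "card K2 \<le> card I" using fin by (auto simp: K2_def intro: card_mono)
  define E where "E z i = (\<Sum>k\<in>K1. z k * V' k i)" for z i
  define F where "F z i = (\<Sum>k\<in>K2. z k * V k i)" for z i
  have E: "normsq I (E z) = (\<Sum>k\<in>K1. (cmod (z k))\<^sup>2)" "quad_form I M' (E z) \<le> (x - \<delta>) * normsq I (E z)" for z
  proof -
    show 1: "normsq I (E z) = (\<Sum>k\<in>K1. (cmod (z k))\<^sup>2)"
      unfolding E_def[abs_def] using orth' eig' fK
      by (intro orthonormal_eigen_lincomb[where d = d' and M = M']) (auto simp: K1_def)
    have "quad_form I M' (E z) = (\<Sum>k\<in>K1. d' k * (cmod (z k))\<^sup>2)"
      unfolding E_def[abs_def] using orth' eig' fK
      by (intro orthonormal_eigen_lincomb) (auto simp: K1_def)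
    also have "\<dots> \<le> (\<Sum>k\<in>K1. (x - \<delta>) * (cmod (z k))\<^sup>2)"
      using d_le by (intro sum_mono mult_right_mono) (fastforce simp: K1_def)+
    finally show "quad_form I M' (E z) \<le> (x - \<delta>) * normsq I (E z)" by (simp add: 1 sum_distrib_left)
  qed
  have F: "normsq I (F z) = (\<Sum>k\<in>K2. (cmod (z k))\<^sup>2)" "(x + \<delta>) * normsq I (F z) \<le> quad_form I M (F z)" for z
  proof -
    show 1: "normsq I (F z) = (\<Sum>k\<in>K2. (cmod (z k))\<^sup>2)"
      unfolding F_def[abs_def] using orth eig fK
      by (intro orthonormal_eigen_lincomb[where d = d and M = M]) (auto simp: K2_def)
    have "(x + \<delta>) * normsq I (F z) = (\<Sum>k\<in>K2. (x + \<delta>) * (cmod (z k))\<^sup>2)" by (simp add: 1 sum_distrib_left)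
    also have "\<dots> \<le> (\<Sum>k\<in>K2. d k * (cmod (z k))\<^sup>2)"
      using d_le by (intro sum_mono mult_right_mono) (fastforce simp: K2_def)+
    also have "\<dots> = quad_form I M (F z)"
      unfolding F_def[abs_def] using orth eig fK
      by (intro orthonormal_eigen_lincomb(2)[symmetric]) (auto simp: K2_def)
    finally show "(x + \<delta>) * normsq I (F z) \<le> quad_form I M (F z)" .
  qed
  \<comment> \<open>The columns of \<open>W\<close> are the basis of E followed by that of F. The
    sum is disjoint because one index may be used by both families.\<close>
  define K where "K = K1 <+> K2"
  define W where "W i k = (case k of Inl k \<Rightarrow> V' k i | Inr k \<Rightarrow> V k i)" for i k
  have fK': "finite K" "card K = card K1 + card K2" using fK by (auto simp: K_def card_Plus)
  have W: "(\<Sum>k\<in>K. W i k * (s k * z k)) =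
      E (\<lambda>k. s (Inl k) * z (Inl k)) i + F (\<lambda>k. s (Inr k) * z (Inr k)) i" for i z s
    using fK by (simp add: K_def sum.Plus W_def E_def F_def mult.commute)
  have ker: "\<forall>k\<in>K. z k = 0" if "\<And>i. i \<in> I \<Longrightarrow> (\<Sum>k\<in>K. W i k * z k) = 0" for z
  proof -
    let ?e = "E (\<lambda>k. z (Inl k))" and ?f = "F (\<lambda>k. z (Inr k))"
    have ef: "?f i = - 1 * ?e i" if "i \<in> I" for i
      using that \<open>\<And>i. i \<in> I \<Longrightarrow> (\<Sum>k\<in>K. W i k * z k) = 0\<close>[of i] W[of i "\<lambda>_. 1" z]
      by (simp add: add_eq_0_iff)
    have normsq: "normsq I ?f = normsq I ?e"
      using normsq_cong[of I ?f, OF ef] by (simp add: normsq_def)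
    have "quad_form I M ?f = quad_form I M (\<lambda>i. - 1 * ?e i)" by (rule quad_form_cong) (use ef in auto)
    also have "\<dots> = quad_form I M ?e" unfolding quad_form_def matvec_scale inner_on_scale_left inner_on_scale_right by simp
    finally have "(x + \<delta>) * normsq I ?e \<le> (x - \<delta>) * normsq I ?e"
      using E(2)[of "\<lambda>k. z (Inl k)"] F(2)[of "\<lambda>k. z (Inr k)"] le[of ?e] normsq by simp
    then have "\<delta> * normsq I ?e \<le> 0" by (simp add: algebra_simps)
    then have "normsq I ?e = 0" using \<delta> normsq_nonneg[of I ?e] by (simp add: mult_le_0_iff)
    with normsq have "(\<Sum>k\<in>K1. (cmod (z (Inl k)))\<^sup>2) = 0" "(\<Sum>k\<in>K2. (cmod (z (Inr k)))\<^sup>2) = 0"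
      using E(1) F(1) by auto
    then show ?thesis using fK by (auto simp: K_def sum_nonneg_eq_0_iff)
  qed
  have "card K \<le> card I"
    using underdetermined_system[OF fin fK'(1), of W] ker by (meson not_le)
  then show "card {k\<in>I. d' k < x} \<le> card {k\<in>I. d k < x}"
    using card2 fK'(2) by (simp add: K1_def)
  assume "card {k\<in>I. d' k < x} = card {k\<in>I. d k < x}"
  then have "card I = card K" using card2 le2 fK'(2) by (simp add: K1_def)
  then obtain b where b: "\<And>i j. i \<in> I \<Longrightarrow> j \<in> I \<Longrightarrow> (\<Sum>k\<in>K. W i k * b k j) = of_bool (i = j)"
    by (rule trivial_kernel_imp_inverse[where c = W, OF fin fK'(1) _ ker]) (use that in blast)+
  define s where "s k = (case k of Inl k \<Rightarrow> - 1 | Inr k \<Rightarrow> (1 :: complex))" for k :: "'i + 'i"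
  \<comment> \<open>\<open>S = W diag(s) W^-1\<close>. With \<open>z = W^-1 u\<close>, the equation
    \<open>sw\<close> below reproduces \<open>u\<close> for the weights \<open>t = 1\<close> and
    gives \<open>S u\<close> for \<open>t = s\<close>.\<close>
  define S where "S i j = (\<Sum>k\<in>K. W i k * (s k * b k j))" for i j
  have "\<exists>e f. (\<forall>i\<in>I. u i = e i + f i \<and> matvec I S u i = f i - e i) \<and>
        quad_form I M' e \<le> (x - \<delta>) * normsq I e \<and> (x + \<delta>) * normsq I f \<le> quad_form I M f" for u
  proof -
    define z where "z k = (\<Sum>j\<in>I. b k j * u j)" for k
    have sw: "(\<Sum>k\<in>K. W i k * (t k * z k)) = (\<Sum>j\<in>I. (\<Sum>k\<in>K. W i k * (t k * b k j)) * u j)" for i t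
      unfolding z_def sum_distrib_left sum_distrib_right
      by (subst sum.swap) (simp add: mult.assoc)
    have "u i = E (\<lambda>k. z (Inl k)) i + F (\<lambda>k. z (Inr k)) i" if "i \<in> I" for i
    proof -
      have "u i = (\<Sum>j\<in>I. of_bool (i = j) * u j)" using that fin by simp
      also have "\<dots> = (\<Sum>k\<in>K. W i k * (1 * z k))"
        unfolding sw using b that by (intro sum.cong) auto
      finally show ?thesis unfolding W by simp
    qed
    moreover have "matvec I S u i = F (\<lambda>k. z (Inr k)) i - E (\<lambda>k. z (Inl k)) i" for i
    proof -
      have "matvec I S u i = (\<Sum>k\<in>K. W i k * (s k * z k))" unfolding sw matvec_def S_def ..
      then show ?thesis unfolding W by (simp add: s_def E_def F_def sum_negf)
    qed
    ultimately show ?thesis using E F by blast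
  qed
  with \<delta> show "\<exists>S \<delta>. \<delta> > 0 \<and> (\<forall>u. \<exists>e f. (\<forall>i\<in>I. u i = e i + f i \<and> matvec I S u i = f i - e i) \<and>
        quad_form I M' e \<le> (x - \<delta>) * normsq I e \<and> (x + \<delta>) * normsq I f \<le> quad_form I M f)" by blast
qed

text \<open>Here \<open>P\<close> is the adjoint of \<open>S\<close>, and \<open>u0\<close>, \<open>u\<close>, \<open>u1\<close> are consecutive blocks of a sequence. The
  terms \<open>\<theta>\<close> telescope when the bound is summed over all blocks.\<close>

lemma block_coercive:
  assumes fin: "finite I" and M: "hermitian_on I M"
    and D: "\<And>u w. 2 * \<bar>Re (inner_on I (matvec I A w) u)\<bar> \<le> quad_form I D1 w + quad_form I D2 u"
    and \<delta>: "\<delta> > 0"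
    and S: "\<And>u. \<exists>e f. (\<forall>i\<in>I. u i = e i + f i \<and> matvec I S u i = f i - e i) \<and>
        quad_form I (\<lambda>i j. M i j + (D1 i j + D2 i j)) e \<le> (x - \<delta>) * normsq I e \<and>
        (x + \<delta>) * normsq I f \<le> quad_form I (\<lambda>i j. M i j - (D1 i j + D2 i j)) f"
  obtains P c \<theta> C where "c > 0"
    "\<And>z. (\<And>i. i \<in> I \<Longrightarrow> matvec I P z i = 0) \<Longrightarrow> \<forall>i\<in>I. z i = 0"
    "\<And>u0 u u1. c * normsq I u + \<theta> u0 u - \<theta> u u1 \<le> Re (inner_on I (matvec I P
       (\<lambda>i. matvec I M u i + matvec I A u1 i + matvec I (\<lambda>i j. cnj (A j i)) u0 i - of_real x * u i)) u)"
    "\<And>u0 u. \<bar>\<theta> u0 u\<bar> \<le> C * (normsq I u0 + normsq I u)"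
proof -
  define P where "P i j = cnj (S j i)" for i j
  \<comment> \<open>From \<open>u = e + f\<close> and \<open>S u = f - e\<close> both components can
    be recovered from \<open>S\<close>, so the vectors merely claimed to exist become explicit
    linear functions of \<open>u\<close>.\<close>
  define e where "e u i = (u i - matvec I S u i) / 2" for u i
  define f where "f u i = (u i + matvec I S u i) / 2" for u i
  have ef: "u i = e u i + f u i" "matvec I S u i = f u i - e u i" for u i
    by (auto simp: e_def f_def field_simps)
  have Se: "quad_form I M (e u) + quad_form I D1 (e u) + quad_form I D2 (e u) \<le> (x - \<delta>) * normsq I (e u)"
    and Sf: "(x + \<delta>) * normsq I (f u) \<le> quad_form I M (f u) - quad_form I D1 (f u) - quad_form I D2 (f u)" for u
  proof -
    obtain e' f' where *: "\<And>i. i \<in> I \<Longrightarrow> u i = e' i + f' i \<and> matvec I S u i = f' i - e' i"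
        "quad_form I (\<lambda>i j. M i j + (D1 i j + D2 i j)) e' \<le> (x - \<delta>) * normsq I e'"
        "(x + \<delta>) * normsq I f' \<le> quad_form I (\<lambda>i j. M i j - (D1 i j + D2 i j)) f'"
      using S[of u] by blast
    have e': "e' i = e u i" "f' i = f u i" if "i \<in> I" for i
      using *(1)[OF that] by (auto simp: e_def f_def field_simps)
    note c = normsq_cong[of I e' "e u", OF e'(1)] quad_form_cong[of I e' "e u", OF e'(1)]
      normsq_cong[of I f' "f u", OF e'(2)] quad_form_cong[of I f' "f u", OF e'(2)]
    show "quad_form I M (e u) + quad_form I D1 (e u) + quad_form I D2 (e u) \<le> (x - \<delta>) * normsq I (e u)"
      using *(2) c by (simp add: quad_form_mat_add)
    show "(x + \<delta>) * normsq I (f u) \<le> quad_form I M (f u) - quad_form I D1 (f u) - quad_form I D2 (f u)"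
      using *(3) c by (simp add: quad_form_mat_add quad_form_mat_diff)
  qed
  have Dpos: "quad_form I D1 u + quad_form I D2 u \<ge> 0" for u
    using D[of u u] abs_ge_zero[of "Re (inner_on I (matvec I A u) u)"] by linarith
  \<comment> \<open>If \<open>S u = 0\<close>, the two components coincide, and one vector obeys the
    upper bound for E and the lower bound for F; only 0 does. Hence \<open>S\<close> is onto, and
    its adjoint \<open>P\<close> is injective.\<close>
  have ker: "\<forall>i\<in>I. u i = 0" if "\<And>i. i \<in> I \<Longrightarrow> (\<Sum>j\<in>I. S i j * u j) = 0" for u
  proof -
    have eq: "e u i = f u i" if "i \<in> I" for i
      using \<open>\<And>i. i \<in> I \<Longrightarrow> (\<Sum>j\<in>I. S i j * u j) = 0\<close>[OF that] by (simp add: e_def f_def matvec_def)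
    have c: "normsq I (e u) = normsq I (f u)" "\<And>M. quad_form I M (e u) = quad_form I M (f u)"
      using eq by (auto intro: normsq_cong quad_form_cong)
    have "(x + \<delta>) * normsq I (f u) \<le> (x - \<delta>) * normsq I (f u)"
      using Se[of u] Sf[of u] Dpos[of "f u"] unfolding c by linarith
    then have "\<delta> * normsq I (f u) \<le> 0" by (simp add: algebra_simps)
    then have "normsq I (f u) = 0" using \<delta> normsq_nonneg[of I "f u"] by (simp add: mult_le_0_iff)
    then have "\<forall>i\<in>I. f u i = 0" using fin by (simp add: normsq_eq_0_iff)
    then show ?thesis using eq ef(1)[of u] by (metis add.right_neutral)
  qed
  obtain b where b: "\<And>i j. i \<in> I \<Longrightarrow> j \<in> I \<Longrightarrow> (\<Sum>k\<in>I. S i k * b k j) = of_bool (i = j)"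
    by (rule trivial_kernel_imp_inverse[where c = S, OF fin fin refl ker]) (use that in blast)+
  have inj: "\<forall>i\<in>I. z i = 0" if z: "\<And>i. i \<in> I \<Longrightarrow> matvec I P z i = 0" for z
  proof -
    have Sb: "matvec I S (matvec I b z) i = z i" if "i \<in> I" for i
    proof -
      have "matvec I S (matvec I b z) i = (\<Sum>j\<in>I. (\<Sum>k\<in>I. S i k * b k j) * z j)"
        unfolding matvec_def sum_distrib_left sum_distrib_right by (subst sum.swap) (simp add: mult.assoc)
      also have "\<dots> = (\<Sum>j\<in>I. of_bool (i = j) * z j)" using b that by (intro sum.cong) auto
      also have "\<dots> = z i" using that fin by simp
      finally show ?thesis .
    qed
    have "of_real (normsq I z) = inner_on I z (matvec I S (matvec I b z))"
      unfolding inner_on_self[symmetric] using Sb by (intro inner_on_cong) auto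
    also have "\<dots> = inner_on I (matvec I P z) (matvec I b z)"
      unfolding inner_on_matvec_adjoint[of I P] P_def complex_cnj_cnj ..
    also have "\<dots> = 0" using z by (simp add: inner_on_def)
    finally show ?thesis using fin by (simp add: normsq_eq_0_iff)
  qed
  define h where "h u = quad_form I D1 (e u) + quad_form I D1 (f u)" for u
  \<comment> \<open>\<open>Se\<close> and \<open>Sf\<close> supply both \<open>D1\<close> and
    \<open>D2\<close> on the block \<open>u\<close>, whereas \<open>D\<close> spends
    \<open>D2\<close> on \<open>u\<close> and \<open>D1\<close> on its successor \<open>u1\<close>;
    the balance is \<open>h u - h u1\<close>. The second summand is the part of the coupling between
    \<open>u0\<close> and \<open>u\<close> that has no sign.\<close>
  define \<theta> where "\<theta> u0 u = h u + Re (inner_on I u0 (matvec I A (matvec I S u)))" for u0 u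
  have low: "\<delta> / 2 * normsq I u + \<theta> u0 u - \<theta> u u1 \<le> Re (inner_on I (matvec I P
       (\<lambda>i. matvec I M u i + matvec I A u1 i + matvec I (\<lambda>i j. cnj (A j i)) u0 i - of_real x * u i)) u)" for u0 u u1
  proof -
    let ?A = "\<lambda>u v. Re (inner_on I (matvec I A u) v)"
    let ?z = "\<lambda>i. matvec I M u i + matvec I A u1 i + matvec I (\<lambda>i j. cnj (A j i)) u0 i - of_real x * u i"
    have S_eq: "matvec I S u = (\<lambda>i. f u i - e u i)" for u using ef(2) by auto
    have u_eq: "u = (\<lambda>i. e u i + f u i)" for u using ef(1) by auto
    have sym: "Re (inner_on I v u) = Re (inner_on I u v)" for u v by (subst inner_on_commute) simp
    have "Re (inner_on I (matvec I P ?z) u) = Re (inner_on I ?z (matvec I S u))"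
      unfolding inner_on_matvec_adjoint[of I P] P_def complex_cnj_cnj ..
    also have "\<dots> = Re (inner_on I (matvec I M u) (matvec I S u)) + ?A u1 (matvec I S u)
        + Re (inner_on I u0 (matvec I A (matvec I S u))) - x * Re (inner_on I u (matvec I S u))"
      by (simp add: inner_on_add_left inner_on_diff_left inner_on_scale_left inner_on_matvec_adjoint[of I "\<lambda>i j. cnj (A j i)"])
    also have "Re (inner_on I (matvec I M u) (matvec I S u)) = quad_form I M (f u) - quad_form I M (e u)"
    proof -
      have "inner_on I (matvec I M (f u)) (e u) = cnj (inner_on I (matvec I M (e u)) (f u))"
        by (subst inner_on_commute) (simp add: inner_on_matvec_hermitian[OF M])
      then show ?thesis
        by (subst (1) u_eq, subst S_eq)
          (simp add: matvec_add inner_on_add_left inner_on_diff_right quad_form_def)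
    qed
    also have "Re (inner_on I u (matvec I S u)) = normsq I (f u) - normsq I (e u)"
      by (subst (1) u_eq, subst S_eq)
        (use sym[of "f u" "e u"] in \<open>simp add: inner_on_add_left inner_on_diff_right inner_on_self\<close>)
    \<comment> \<open>Adding the subtracted term to the left side cancels the mixed products and
      doubles those of equal type. The same term returns with a plus sign in the next block, through
      the adjoint of \<open>A\<close>.\<close>
    also have "?A u1 (matvec I S u) = 2 * ?A (f u1) (f u) - 2 * ?A (e u1) (e u) - Re (inner_on I u (matvec I A (matvec I S u1)))"
    proof -
      have 1: "?A u1 (matvec I S u) = ?A (e u1) (f u) + ?A (f u1) (f u) - ?A (e u1) (e u) - ?A (f u1) (e u)"
        by (subst (1) u_eq, subst S_eq) (simp add: matvec_add inner_on_add_left inner_on_diff_right)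
      have 2: "Re (inner_on I u (matvec I A (matvec I S u1))) =
          ?A (f u1) (e u) + ?A (f u1) (f u) - ?A (e u1) (e u) - ?A (e u1) (f u)"
        by (subst sym, subst S_eq, subst (4) u_eq) (simp add: matvec_diff inner_on_diff_left inner_on_add_right)
      show ?thesis unfolding 1 2 by simp
    qed
    finally have eq: "Re (inner_on I (matvec I P ?z) u) = quad_form I M (f u) - quad_form I M (e u) + (2 * ?A (f u1) (f u) - 2 * ?A (e u1) (e u) - Re (inner_on I u (matvec I A (matvec I S u1))))
       + Re (inner_on I u0 (matvec I A (matvec I S u))) - x * (normsq I (f u) - normsq I (e u))" .
    \<comment> \<open>The components need not be orthogonal; this costs a factor 2 and explains the
      constant \<open>\<delta> / 2\<close>.\<close>
    have "normsq I u \<le> 2 * normsq I (e u) + 2 * normsq I (f u)"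
      by (subst (1) u_eq) (rule normsq_add_le)
    then have "\<delta> / 2 * normsq I u \<le> \<delta> / 2 * (2 * normsq I (e u) + 2 * normsq I (f u))"
      using \<delta> by (intro mult_left_mono) auto
    then show ?thesis
      unfolding eq \<theta>_def h_def
      using Se[of u] Sf[of u] D[of "f u1" "f u"] D[of "e u1" "e u"]
      by (simp add: algebra_simps abs_le_iff)
  qed
  \<comment> \<open>The remaining estimates bound \<open>\<theta>\<close>, so that it can be summed
    over all blocks.\<close>
  obtain CS where CS: "CS \<ge> 0" "\<And>u. normsq I (matvec I S u) \<le> CS * normsq I u" using normsq_matvec_bounded[of I S] by blast
  obtain CA where CA: "CA \<ge> 0" "\<And>u. normsq I (matvec I A u) \<le> CA * normsq I u" using normsq_matvec_bounded[of I A] by blast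
  obtain CD where CD: "CD \<ge> 0" "\<And>u. normsq I (matvec I D1 u) \<le> CD * normsq I u" using normsq_matvec_bounded[of I D1] by blast
  have ens: "normsq I (e u) \<le> (1 + CS) * normsq I u" "normsq I (f u) \<le> (1 + CS) * normsq I u" for u
  proof -
    have "normsq I (e u) = (cmod (1/2))\<^sup>2 * normsq I (\<lambda>i. u i - matvec I S u i)"
      unfolding normsq_scale[symmetric] by (simp add: e_def[abs_def])
    then have "4 * normsq I (e u) = normsq I (\<lambda>i. u i - matvec I S u i)" by (simp add: power2_eq_square)
    then show "normsq I (e u) \<le> (1 + CS) * normsq I u"
      using normsq_diff_le[of I u "matvec I S u"] CS(2)[of u] normsq_nonneg[of I u] mult_nonneg_nonneg[OF CS(1), of "normsq I u"]
      unfolding distrib_right by linarith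
    have "normsq I (f u) = (cmod (1/2))\<^sup>2 * normsq I (\<lambda>i. u i + matvec I S u i)"
      unfolding normsq_scale[symmetric] by (simp add: f_def[abs_def])
    then have "4 * normsq I (f u) = normsq I (\<lambda>i. u i + matvec I S u i)" by (simp add: power2_eq_square)
    then show "normsq I (f u) \<le> (1 + CS) * normsq I u"
      using normsq_add_le[of I u "matvec I S u"] CS(2)[of u] normsq_nonneg[of I u] mult_nonneg_nonneg[OF CS(1), of "normsq I u"]
      unfolding distrib_right by linarith
  qed
  have qD: "\<bar>quad_form I D1 v\<bar> \<le> (1 + CD) * normsq I v" for v
    using abs_Re_inner_on_le[of I "matvec I D1 v" v] CD(2)[of v] normsq_nonneg[of I v] mult_nonneg_nonneg[OF CD(1), of "normsq I v"]
    unfolding quad_form_def by (simp add: algebra_simps)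
  have hb: "\<bar>h u\<bar> \<le> 2 * (1 + CD) * (1 + CS) * normsq I u" for u
  proof -
    have "\<bar>h u\<bar> \<le> (1 + CD) * normsq I (e u) + (1 + CD) * normsq I (f u)"
      unfolding h_def using qD[of "e u"] qD[of "f u"] by linarith
    also have "\<dots> \<le> (1 + CD) * ((1 + CS) * normsq I u) + (1 + CD) * ((1 + CS) * normsq I u)"
      using ens CD by (intro add_mono mult_left_mono) auto
    finally show ?thesis by (simp add: algebra_simps)
  qed
  have ASb: "normsq I (matvec I A (matvec I S u)) \<le> CA * CS * normsq I u" for u
    using order_trans[OF CA(2) mult_left_mono[OF CS(2) CA(1)]] by (simp add: mult.assoc)
  define C where "C = 2 * (1 + CD) * (1 + CS) + CA * CS + 1"
  have \<theta>b: "\<bar>\<theta> u0 u\<bar> \<le> C * (normsq I u0 + normsq I u)" for u0 u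
  proof -
    have "\<bar>\<theta> u0 u\<bar> \<le> 2 * (1 + CD) * (1 + CS) * normsq I u + (normsq I u0 + CA * CS * normsq I u) / 2"
    proof -
      have "\<bar>Re (inner_on I u0 (matvec I A (matvec I S u)))\<bar> \<le> (normsq I u0 + CA * CS * normsq I u) / 2"
        using abs_Re_inner_on_le[of I u0 "matvec I A (matvec I S u)"] ASb[of u] by argo
      then show ?thesis unfolding \<theta>_def by (rule order_trans[OF abs_triangle_ineq add_mono[OF hb]])
    qed
    also have "\<dots> \<le> 2 * (1 + CD) * (1 + CS) * (normsq I u0 + normsq I u) + (1 + CA * CS) * (normsq I u0 + normsq I u)"
    proof (rule add_mono)
      show "2 * (1 + CD) * (1 + CS) * normsq I u \<le> 2 * (1 + CD) * (1 + CS) * (normsq I u0 + normsq I u)"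
        using CD CS by (intro mult_left_mono) auto
      have "0 \<le> CA * CS * normsq I u" "0 \<le> CA * CS * normsq I u0" using CA CS by auto
      then show "(normsq I u0 + CA * CS * normsq I u) / 2 \<le> (1 + CA * CS) * (normsq I u0 + normsq I u)"
        using normsq_nonneg[of I u] normsq_nonneg[of I u0] unfolding distrib_left distrib_right by argo
    qed
    finally show ?thesis unfolding C_def distrib_right by simp
  qed
  show ?thesis
    by (rule that[of "\<delta> / 2" P \<theta> C]) (use \<delta> inj low \<theta>b in auto)
qed

subsection \<open>Square-summable sequences\<close>

lemma norm_vector_scalar_mult: "norm (c *s x) = cmod c * norm x" for x :: "complex ^ 'm"
  by (simp add: norm_vec_def norm_mult L2_set_right_distrib)

lemma ell2_norm_nonneg [simp]: "0 \<le> ell2_norm y"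
  by (simp add: ell2_norm_def infsum_nonneg)

lemma ell2_norm_power2: "(ell2_norm y)\<^sup>2 = (\<Sum>\<^sub>\<infinity>n\<in>UNIV. (norm (y n))\<^sup>2)"
  by (simp add: ell2_norm_def infsum_nonneg)

lemma L2_set_le_ell2_norm:
  assumes "y \<in> ell2"
  shows "L2_set (\<lambda>n. norm (y n)) F \<le> ell2_norm y"
proof (cases "finite F")
  case True
  then show ?thesis
    unfolding L2_set_def ell2_norm_def
    using assms by (intro real_sqrt_le_mono finite_sum_le_infsum) (auto simp: ell2_def)
qed simp

lemma norm_le_ell2_norm: "y \<in> ell2 \<Longrightarrow> norm (y n) \<le> ell2_norm y"
  using L2_set_le_ell2_norm[of y "{n}"] by simp

text \<open>Bounds on finite sections survive coordinatewise limits, so this leads from a pointwise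
  limit back to \<open>ell2\<close>. It also transfers Minkowski's inequality from
  \<open>L2_set\<close>.\<close>

lemma ell2_L2_setI:
  assumes "\<And>F. finite F \<Longrightarrow> L2_set (\<lambda>n. norm (y n)) F \<le> B"
  shows "y \<in> ell2" "ell2_norm y \<le> B"
proof -
  have B: "B \<ge> 0" using assms[of "{}"] by simp
  have le: "(\<Sum>n\<in>F. (norm (y n))\<^sup>2) \<le> B\<^sup>2" if "finite F" for F
    using power_mono[OF assms[OF that], of 2] by (simp add: L2_set_def sum_nonneg)
  have "bdd_above (sum (\<lambda>n. (norm (y n))\<^sup>2) ` {F. F \<subseteq> UNIV \<and> finite F})"
    by (rule bdd_aboveI2[of _ _ "B\<^sup>2"]) (use le in blast)
  then show y: "y \<in> ell2" unfolding ell2_def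
    by (simp add: nonneg_bdd_above_summable_on)
  have "(\<Sum>\<^sub>\<infinity>n\<in>UNIV. (norm (y n))\<^sup>2) \<le> B\<^sup>2"
    using y le by (intro infsum_le_finite_sums) (auto simp: ell2_def)
  then show "ell2_norm y \<le> B"
    unfolding ell2_norm_def using B by (intro real_le_lsqrt) auto
qed

lemma
  assumes "y \<in> ell2" "z \<in> ell2"
  shows ell2_add: "(\<lambda>n. y n + z n) \<in> ell2"
    and ell2_norm_triangle: "ell2_norm (\<lambda>n. y n + z n) \<le> ell2_norm y + ell2_norm z"
proof -
  have "L2_set (\<lambda>n. norm (y n + z n)) F \<le> ell2_norm y + ell2_norm z" for F
  proof -
    have "L2_set (\<lambda>n. norm (y n + z n)) F \<le> L2_set (\<lambda>n. norm (y n) + norm (z n)) F"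
      by (intro L2_set_mono norm_triangle_ineq) auto
    also have "\<dots> \<le> L2_set (\<lambda>n. norm (y n)) F + L2_set (\<lambda>n. norm (z n)) F"
      by (rule L2_set_triangle_ineq)
    finally show ?thesis using L2_set_le_ell2_norm[OF assms(1), of F] L2_set_le_ell2_norm[OF assms(2), of F]
      by linarith
  qed
  then show "(\<lambda>n. y n + z n) \<in> ell2" "ell2_norm (\<lambda>n. y n + z n) \<le> ell2_norm y + ell2_norm z"
    using ell2_L2_setI[of "\<lambda>n. y n + z n"] by blast+
qed

lemma
  assumes "y \<in> ell2"
  shows ell2_scale: "(\<lambda>n. c *s y n) \<in> ell2"
    and ell2_norm_scale: "ell2_norm (\<lambda>n. c *s y n) = cmod c * ell2_norm y"
proof -
  show "(\<lambda>n. c *s y n) \<in> ell2" using assms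
    by (simp add: ell2_def norm_vector_scalar_mult power_mult_distrib summable_on_cmult_right)
  show "ell2_norm (\<lambda>n. c *s y n) = cmod c * ell2_norm y"
    by (simp add: ell2_norm_def norm_vector_scalar_mult power_mult_distrib infsum_cmult_right' real_sqrt_mult)
qed

lemma ell2_norm_uminus: "ell2_norm (\<lambda>n. - y n) = ell2_norm y"
  by (simp add: ell2_norm_def)

lemma
  assumes "y \<in> ell2" "z \<in> ell2"
  shows ell2_diff: "(\<lambda>n. y n - z n) \<in> ell2"
    and ell2_norm_triangle_diff: "ell2_norm (\<lambda>n. y n - z n) \<le> ell2_norm y + ell2_norm z"
  using ell2_add[of y "\<lambda>n. - z n"] ell2_norm_triangle[of y "\<lambda>n. - z n"] assms
  by (auto simp: ell2_norm_uminus) (auto simp: ell2_def)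

section \<open>Fixed points and resolvent criteria in \<open>ell2\<close>\<close>

lemma ell2_zero: "(\<lambda>_. 0) \<in> ell2"
  by (simp add: ell2_def)

lemma ell2_norm_eq_0: "y \<in> ell2 \<Longrightarrow> ell2_norm y = 0 \<Longrightarrow> y n = 0"
  using norm_le_ell2_norm[of y n] by simp

text \<open>Banach's argument: the iterates starting at 0 form a Cauchy sequence in every
  coordinate, and uniform bounds on finite sections turn the coordinatewise limit into a limit in
  norm.\<close>

lemma ell2_contraction_fixpoint:
  fixes Q :: "(int \<Rightarrow> complex ^ 'm) \<Rightarrow> int \<Rightarrow> complex ^ 'm"
  assumes Q: "\<And>u. u \<in> ell2 \<Longrightarrow> Q u \<in> ell2"
    and q: "0 \<le> q" "q < 1"
    and contr: "\<And>u v. u \<in> ell2 \<Longrightarrow> v \<in> ell2 \<Longrightarrow>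
      ell2_norm (\<lambda>n. Q u n - Q v n) \<le> q * ell2_norm (\<lambda>n. u n - v n)"
  obtains u where "u \<in> ell2" "Q u = u"
proof -
  define U where "U k = (Q ^^ k) (\<lambda>_. 0)" for k
  have U_Suc: "U (Suc k) = Q (U k)" for k by (simp add: U_def)
  have U: "U k \<in> ell2" for k by (induction k) (auto simp: U_def ell2_zero Q)
  define D where "D = ell2_norm (\<lambda>n. U 1 n - U 0 n)"
  have step: "ell2_norm (\<lambda>n. U (Suc k) n - U k n) \<le> q ^ k * D" for k
  proof (induction k)
    case 0
    then show ?case by (simp add: D_def)
  next
    case (Suc k)
    have "ell2_norm (\<lambda>n. U (Suc (Suc k)) n - U (Suc k) n) \<le> q * ell2_norm (\<lambda>n. U (Suc k) n - U k n)"
      using contr[OF U[of "Suc k"] U[of k]] by (simp add: U_Suc)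
    also have "\<dots> \<le> q * (q ^ k * D)" using Suc q by (intro mult_left_mono)
    finally show ?case by (simp add: mult.assoc)
  qed
  \<comment> \<open>The geometric tail of the step lengths:
    \<open>E k - E (k + 1) = q ^ k * D\<close>. Stating \<open>tail\<close> with a difference of two
    values of \<open>E\<close> lets its induction telescope.\<close>
  define E where "E k = q ^ k * (D / (1 - q))" for k
  have D: "D \<ge> 0" by (simp add: D_def)
  have tail: "ell2_norm (\<lambda>n. U (k + l) n - U k n) \<le> E k - E (k + l)" for k l
  proof (induction l)
    case 0
    have "ell2_norm (\<lambda>_. 0 :: complex ^ 'm) = 0" by (simp add: ell2_norm_def)
    then show ?case by simp
  next
    case (Suc l)
    have "ell2_norm (\<lambda>n. U (k + Suc l) n - U k n)
        = ell2_norm (\<lambda>n. (U (Suc (k + l)) n - U (k + l) n) + (U (k + l) n - U k n))" by simp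
    also have "\<dots> \<le> q ^ (k + l) * D + (E k - E (k + l))"
      by (intro order_trans[OF ell2_norm_triangle] add_mono step Suc ell2_diff U)
    also have "q ^ (k + l) * D = E (k + l) - E (k + Suc l)"
    proof -
      have "q ^ (k + l) * D = q ^ (k + l) * ((1 - q) * (D / (1 - q)))" using q by simp
      also have "\<dots> = E (k + l) - E (k + Suc l)"
        unfolding E_def left_diff_distrib right_diff_distrib by simp
      finally show ?thesis .
    qed
    finally show ?case by simp
  qed
  have E0: "E k \<ge> 0" for k using q D by (simp add: E_def)
  have tail': "ell2_norm (\<lambda>n. U (k + l) n - U k n) \<le> E k" for k l
    using tail[of k l] E0[of "k + l"] by linarith
  have "(\<lambda>k. q ^ k * (D / (1 - q))) \<longlonglongrightarrow> 0 * (D / (1 - q))"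
    using q by (intro tendsto_mult LIMSEQ_power_zero tendsto_const) auto
  then have E_lim: "E \<longlonglongrightarrow> 0" by (simp add: E_def[abs_def])
  have "convergent (\<lambda>k. U k n)" for n
  proof -
    have "Cauchy (\<lambda>k. U k n)"
    proof (rule CauchyI')
      fix e :: real assume "e > 0"
      with E_lim have "eventually (\<lambda>k. E k < e) sequentially" by (rule order_tendstoD)
      then obtain N where N: "\<And>k. k \<ge> N \<Longrightarrow> E k < e" by (auto simp: eventually_sequentially)
      have "dist (U k n) (U m n) < e" if "N \<le> k" "k < m" for k m
      proof -
        have "dist (U k n) (U m n) = norm (U (k + (m - k)) n - U k n)"
          using that by (simp add: dist_norm norm_minus_commute)
        also have "\<dots> \<le> ell2_norm (\<lambda>n. U (k + (m - k)) n - U k n)"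
          by (intro norm_le_ell2_norm[of "\<lambda>n. U (k + (m - k)) n - U k n"] ell2_diff U)
        also have "\<dots> < e" using tail'[of k "m - k"] N[OF that(1)] by linarith
        finally show ?thesis .
      qed
      then show "\<exists>M. \<forall>m\<ge>M. \<forall>n'>m. dist (U m n) (U n' n) < e" by blast
    qed
    then show ?thesis by (simp add: Cauchy_convergent_iff)
  qed
  then obtain u where u: "\<And>n. (\<lambda>k. U k n) \<longlonglongrightarrow> u n" unfolding convergent_def by metis
  \<comment> \<open>A section norm over finitely many coordinates is continuous in them, so the
    bound \<open>tail'\<close> passes to the limit in \<open>l\<close>.\<close>
  have L2: "L2_set (\<lambda>n. norm (u n - U k n)) F \<le> E k" for k F
  proof (rule LIMSEQ_le_const2)
    show "(\<lambda>l. L2_set (\<lambda>n. norm (U (l + k) n - U k n)) F) \<longlonglongrightarrow> L2_set (\<lambda>n. norm (u n - U k n)) F"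
      unfolding L2_set_def using LIMSEQ_ignore_initial_segment[OF u, of k] by (intro tendsto_intros)
    show "\<exists>N. \<forall>l\<ge>N. L2_set (\<lambda>n. norm (U (l + k) n - U k n)) F \<le> E k"
    proof (intro exI[of _ 0] allI impI)
      fix l
      have "L2_set (\<lambda>n. norm (U (k + l) n - U k n)) F \<le> ell2_norm (\<lambda>n. U (k + l) n - U k n)"
        by (intro L2_set_le_ell2_norm ell2_diff U)
      also have "\<dots> \<le> E k" by (rule tail')
      finally show "L2_set (\<lambda>n. norm (U (l + k) n - U k n)) F \<le> E k" by (simp add: add.commute)
    qed
  qed
  note uU = ell2_L2_setI[OF L2]
  have u2: "u \<in> ell2" using ell2_add[OF uU(1)[of 0] U[of 0]] by simp
  have "ell2_norm (\<lambda>n. Q u n - u n) \<le> q * E k + E (Suc k)" for k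
  proof -
    have "ell2_norm (\<lambda>n. Q u n - u n) = ell2_norm (\<lambda>n. (Q u n - Q (U k) n) - (u n - U (Suc k) n))"
      by (simp add: U_Suc)
    also have "\<dots> \<le> ell2_norm (\<lambda>n. Q u n - Q (U k) n) + ell2_norm (\<lambda>n. u n - U (Suc k) n)"
      by (intro ell2_norm_triangle_diff ell2_diff Q U u2)
    also have "\<dots> \<le> q * ell2_norm (\<lambda>n. u n - U k n) + E (Suc k)"
      by (intro add_mono contr U u2 uU)
    also have "\<dots> \<le> q * E k + E (Suc k)"
      using q by (intro add_mono mult_left_mono uU) auto
    finally show ?thesis .
  qed
  moreover have "(\<lambda>k. q * E k + E (Suc k)) \<longlonglongrightarrow> q * 0 + 0"
    by (intro tendsto_intros E_lim LIMSEQ_Suc)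
  ultimately have "ell2_norm (\<lambda>n. Q u n - u n) \<le> q * 0 + 0" by (intro LIMSEQ_le_const) auto
  then have "ell2_norm (\<lambda>n. Q u n - u n) = 0" using ell2_norm_nonneg[of "\<lambda>n. Q u n - u n"] by linarith
  then have "Q u n - u n = 0" for n
    using ell2_norm_eq_0[of "\<lambda>n. Q u n - u n" n] ell2_diff[OF Q[OF u2] u2] by blast
  then show ?thesis using that[OF u2] by (simp add: fun_eq_iff)
qed

text \<open>The lower bound makes preimages unique; uniqueness makes the chosen preimage
  \<open>R w\<close> depend linearly on \<open>w\<close>, and the same bound gives \<open>R\<close>
  the norm bound \<open>1 / \<epsilon>\<close>.\<close>

lemma not_in_spectrumI:
  fixes T :: "(int \<Rightarrow> complex ^ 'm) \<Rightarrow> int \<Rightarrow> complex ^ 'm"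
  assumes add: "\<And>y z. y \<in> ell2 \<Longrightarrow> z \<in> ell2 \<Longrightarrow> T (\<lambda>n. y n + z n) = (\<lambda>n. T y n + T z n)"
    and scale: "\<And>c y. y \<in> ell2 \<Longrightarrow> T (\<lambda>n. c *s y n) = (\<lambda>n. c *s T y n)"
    and T: "\<And>y. y \<in> ell2 \<Longrightarrow> T y \<in> ell2"
    and below: "\<epsilon> > 0" "\<And>y. y \<in> ell2 \<Longrightarrow> \<epsilon> * ell2_norm y \<le> ell2_norm (\<lambda>n. T y n - z *s y n)"
    and surj: "\<And>w. w \<in> ell2 \<Longrightarrow> \<exists>u\<in>ell2. (\<lambda>n. T u n - z *s u n) = w"
  shows "z \<notin> spectrum T"
proof -
  define G where "G y n = T y n - z *s y n" for y n
  have below': "\<epsilon> * ell2_norm y \<le> ell2_norm (G y)" if "y \<in> ell2" for y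
    using below(2)[OF that] by (simp add: G_def[abs_def])
  have Gadd: "G (\<lambda>n. y n + v n) = (\<lambda>n. G y n + G v n)" if "y \<in> ell2" "v \<in> ell2" for y v
    unfolding G_def add[OF that] by (simp add: fun_eq_iff vector_add_ldistrib)
  have Gscale: "G (\<lambda>n. c *s y n) = (\<lambda>n. c *s G y n)" if "y \<in> ell2" for y c
    unfolding G_def scale[OF that] by (simp add: fun_eq_iff vector_ssub_ldistrib vector_smult_assoc mult.commute)
  have Gell2: "G y \<in> ell2" if "y \<in> ell2" for y
    unfolding G_def[abs_def] using T that ell2_scale ell2_diff by blast
  have inj: "u = v" if "u \<in> ell2" "v \<in> ell2" "G u = G v" for u v
  proof -
    have d: "(\<lambda>n. u n + (-1) *s v n) \<in> ell2" using that ell2_add ell2_scale by blast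
    have "G (\<lambda>n. u n + (-1) *s v n) = (\<lambda>n. G u n + (-1) *s G v n)"
      using Gadd[OF that(1) ell2_scale[OF that(2)]] Gscale[OF that(2)] by metis
    then have "G (\<lambda>n. u n + (-1) *s v n) = (\<lambda>_. 0)" using that(3) by (simp add: fun_eq_iff vector_sneg_minus1[symmetric])
    then have "\<epsilon> * ell2_norm (\<lambda>n. u n + (-1) *s v n) \<le> ell2_norm (\<lambda>_::int. 0 :: complex ^ 'm)"
      using below'[OF d] by simp
    then have "ell2_norm (\<lambda>n. u n + (-1) *s v n) = 0"
      using below(1) ell2_norm_nonneg[of "\<lambda>n. u n + (-1) *s v n"]
      by (simp add: ell2_norm_def[of "\<lambda>_. 0"] mult_le_0_iff antisym)
    then have "u n + (-1) *s v n = 0" for n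
      using ell2_norm_eq_0[OF d] by blast
    then show ?thesis by (simp add: fun_eq_iff vector_sneg_minus1[symmetric])
  qed
  define R where "R w = (SOME u. u \<in> ell2 \<and> G u = w)" for w
  have R: "R w \<in> ell2 \<and> G (R w) = w" if "w \<in> ell2" for w
  proof -
    from surj[OF that] obtain u where "u \<in> ell2" "(\<lambda>n. T u n - z *s u n) = w" by blast
    then have "u \<in> ell2 \<and> G u = w" by (simp add: G_def[abs_def])
    then show ?thesis unfolding R_def by (rule someI[where P = "\<lambda>u. u \<in> ell2 \<and> G u = w"])
  qed
  have R_eq: "R w = u" if "u \<in> ell2" "G u = w" for u w
  proof -
    have "w \<in> ell2" using Gell2[OF that(1)] that(2) by blast
    from R[OF this] show ?thesis using that inj[of "R w" u] by simp
  qed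
  have "bounded_operator R"
    unfolding bounded_operator_def
  proof (intro conjI ballI allI exI[of _ "1 / \<epsilon>"])
    fix y v :: "int \<Rightarrow> complex ^ 'm" assume yv: "y \<in> ell2" "v \<in> ell2"
    show "R (\<lambda>n. y n + v n) = (\<lambda>n. R y n + R v n)"
      using R[OF yv(1)] R[OF yv(2)] by (intro R_eq ell2_add) (simp_all add: Gadd)
  next
    fix y :: "int \<Rightarrow> complex ^ 'm" and c assume y: "y \<in> ell2"
    show "R (\<lambda>n. c *s y n) = (\<lambda>n. c *s R y n)"
      using R[OF y] by (intro R_eq ell2_scale) (simp_all add: Gscale)
  next
    fix y :: "int \<Rightarrow> complex ^ 'm" assume y: "y \<in> ell2"
    show "R y \<in> ell2" using R[OF y] by simp
    show "ell2_norm (R y) \<le> 1 / \<epsilon> * ell2_norm y"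
      using below'[of "R y"] R[OF y] below(1) by (simp add: field_simps)
  qed
  moreover have "R (\<lambda>n. T y n - z *s y n) = y" if "y \<in> ell2" for y
    using that by (intro R_eq) (auto simp: G_def[abs_def])
  moreover have "(\<lambda>n. T (R y) n - z *s R y n) = y" if "y \<in> ell2" for y
    using R[OF that] by (simp add: G_def[abs_def])
  ultimately show ?thesis unfolding spectrum_def by blast
qed

text \<open>The contraction is \<open>u \<mapsto> u - t W ((T - z) u - w)\<close>; as \<open>W\<close> is injective, its fixed point solves
  \<open>(T - z) u = w\<close>.\<close>

lemma preconditioned_contraction_not_in_spectrum:
  fixes T W :: "(int \<Rightarrow> complex ^ 'm) \<Rightarrow> int \<Rightarrow> complex ^ 'm"
  assumes add: "\<And>y z. y \<in> ell2 \<Longrightarrow> z \<in> ell2 \<Longrightarrow> T (\<lambda>n. y n + z n) = (\<lambda>n. T y n + T z n)"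
    and scale: "\<And>c y. y \<in> ell2 \<Longrightarrow> T (\<lambda>n. c *s y n) = (\<lambda>n. c *s T y n)"
    and T: "\<And>y. y \<in> ell2 \<Longrightarrow> T y \<in> ell2"
    and W: "\<And>y. y \<in> ell2 \<Longrightarrow> W y \<in> ell2"
    and W_diff: "\<And>y z. y \<in> ell2 \<Longrightarrow> z \<in> ell2 \<Longrightarrow> W (\<lambda>n. y n - z n) = (\<lambda>n. W y n - W z n)"
    and W_bdd: "\<And>y. y \<in> ell2 \<Longrightarrow> ell2_norm (W y) \<le> B * ell2_norm y"
    and W_inj: "\<And>y. y \<in> ell2 \<Longrightarrow> W y = (\<lambda>_. 0) \<Longrightarrow> y = (\<lambda>_. 0)"
    and t: "t > 0" and q: "0 \<le> q" "q < 1"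
    and contr: "\<And>v. v \<in> ell2 \<Longrightarrow>
      ell2_norm (\<lambda>n. v n - of_real t *s W (\<lambda>n. T v n - z *s v n) n) \<le> q * ell2_norm v"
  shows "z \<notin> spectrum T"
proof -
  define G where "G y n = T y n - z *s y n" for y n
  have Gell2: "G y \<in> ell2" if "y \<in> ell2" for y
    unfolding G_def[abs_def] using T that ell2_scale ell2_diff by blast
  have Gdiff: "G (\<lambda>n. y n - v n) = (\<lambda>n. G y n - G v n)" if "y \<in> ell2" "v \<in> ell2" for y v
  proof -
    have "T (\<lambda>n. y n + (-1) *s v n) = (\<lambda>n. T y n + (-1) *s T v n)"
      using add[OF that(1) ell2_scale[OF that(2)]] scale[OF that(2)] by metis
    then have "T (\<lambda>n. y n - v n) = (\<lambda>n. T y n - T v n)"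
      by (simp add: vector_sneg_minus1[symmetric])
    then show ?thesis by (simp add: G_def fun_eq_iff vector_ssub_ldistrib)
  qed
  have contrG: "ell2_norm (\<lambda>n. v n - of_real t *s W (G v) n) \<le> q * ell2_norm v" if "v \<in> ell2" for v
    using contr[OF that] by (simp add: G_def[abs_def])
  show ?thesis
  \<comment> \<open>The contraction property yields \<open>(1 - q) |y| \<le> t |W (G y)|\<close>.
    The factor \<open>\<bar>B\<bar> + 1\<close> bounds \<open>W\<close> and is certainly
    positive.\<close>
  proof (rule not_in_spectrumI[where \<epsilon> = "(1 - q) / (t * (\<bar>B\<bar> + 1))"])
    show "(1 - q) / (t * (\<bar>B\<bar> + 1)) > 0"
      using q t by (intro divide_pos_pos mult_pos_pos) auto
    fix y :: "int \<Rightarrow> complex ^ 'm" assume y: "y \<in> ell2"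
    have WG: "W (G y) \<in> ell2" using y W Gell2 by blast
    have "ell2_norm y = ell2_norm (\<lambda>n. (y n - of_real t *s W (G y) n) + of_real t *s W (G y) n)" by simp
    also have "\<dots> \<le> q * ell2_norm y + ell2_norm (\<lambda>n. of_real t *s W (G y) n)"
      by (rule order_trans[OF ell2_norm_triangle]) (intro ell2_diff y ell2_scale WG add_mono contrG order_refl)+
    also have "ell2_norm (\<lambda>n. of_real t *s W (G y) n) \<le> t * ((\<bar>B\<bar> + 1) * ell2_norm (G y))"
    proof -
      have "B * ell2_norm (G y) \<le> (\<bar>B\<bar> + 1) * ell2_norm (G y)"
        by (intro mult_right_mono) auto
      then have "ell2_norm (W (G y)) \<le> (\<bar>B\<bar> + 1) * ell2_norm (G y)"
        using W_bdd[OF Gell2[OF y]] by linarith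
      then show ?thesis using ell2_norm_scale[OF WG] t by simp
    qed
    finally have "(1 - q) * ell2_norm y \<le> ell2_norm (G y) * (t * (\<bar>B\<bar> + 1))"
      by (simp add: algebra_simps)
    moreover have "t * (\<bar>B\<bar> + 1) > 0" using t by (intro mult_pos_pos) auto
    ultimately show "(1 - q) / (t * (\<bar>B\<bar> + 1)) * ell2_norm y \<le> ell2_norm (\<lambda>n. T y n - z *s y n)"
      unfolding times_divide_eq_left by (subst pos_divide_le_eq) (auto simp: G_def[abs_def])
  next
    fix w :: "int \<Rightarrow> complex ^ 'm" assume w: "w \<in> ell2"
    define Q where "Q u n = u n - of_real t *s W (\<lambda>n. G u n - w n) n" for u n
    have Gw: "(\<lambda>n. G u n - w n) \<in> ell2" if "u \<in> ell2" for u using that Gell2 w ell2_diff by blast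
    have Qell2: "Q u \<in> ell2" if "u \<in> ell2" for u
      unfolding Q_def[abs_def] by (intro ell2_diff that ell2_scale W Gw)
    have Qcontr: "ell2_norm (\<lambda>n. Q u n - Q v n) \<le> q * ell2_norm (\<lambda>n. u n - v n)"
      if uv: "u \<in> ell2" "v \<in> ell2" for u v
    proof -
      have "W (G (\<lambda>n. u n - v n)) = W (\<lambda>n. (G u n - w n) - (G v n - w n))"
        unfolding Gdiff[OF uv] by simp
      also have "\<dots> = (\<lambda>n. W (\<lambda>n. G u n - w n) n - W (\<lambda>n. G v n - w n) n)"
        by (rule W_diff[OF Gw[OF uv(1)] Gw[OF uv(2)]])
      finally have "(\<lambda>n. Q u n - Q v n) = (\<lambda>n. (u n - v n) - of_real t *s W (G (\<lambda>n. u n - v n)) n)"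
        by (simp add: Q_def fun_eq_iff vector_ssub_ldistrib)
      then show ?thesis using contrG[OF ell2_diff[OF uv]] by simp
    qed
    obtain u where u: "u \<in> ell2" "Q u = u"
      by (rule ell2_contraction_fixpoint[OF Qell2 q Qcontr])
    have "of_real t *s W (\<lambda>n. G u n - w n) n = 0" for n
      using fun_cong[OF u(2), of n] by (simp add: Q_def)
    then have "W (\<lambda>n. G u n - w n) = (\<lambda>_. 0)" using t by (simp add: fun_eq_iff)
    then have "(\<lambda>n. G u n - w n) = (\<lambda>_. 0)" using W_inj[OF Gw[OF u(1)]] by simp
    then show "\<exists>u\<in>ell2. (\<lambda>n. T u n - z *s u n) = w"
      using u(1) by (auto simp: G_def fun_eq_iff intro!: bexI[of _ u])
  qed (fact add scale T)+
qed

subsection \<open>Block operators\<close>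

definition block_index :: "int \<Rightarrow> (int \<times> 'm::finite) set" where
  "block_index p = {0..<p} \<times> UNIV"

text \<open>Block \<open>k\<close> starts at site \<open>c + p * k\<close>; the offset
  \<open>c\<close> decides where the lattice is cut.\<close>

definition seq_block :: "int \<Rightarrow> int \<Rightarrow> (int \<Rightarrow> complex ^ 'm) \<Rightarrow> int \<Rightarrow> int \<times> 'm \<Rightarrow> complex" where
  "seq_block p c y k i = y (c + p * k + fst i) $ snd i"

definition seq_unblock :: "int \<Rightarrow> int \<Rightarrow> (int \<Rightarrow> int \<times> 'm \<Rightarrow> complex) \<Rightarrow> int \<Rightarrow> complex ^ 'm" where
  "seq_unblock p c U n = (\<chi> \<alpha>. U ((n - c) div p) ((n - c) mod p, \<alpha>))"

lemma finite_block_index [simp]: "finite (block_index p)"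
  by (simp add: block_index_def)

lemma seq_block_seq_unblock: "i \<in> block_index p \<Longrightarrow> seq_block p c (seq_unblock p c U) k i = U k i"
  by (cases i) (auto simp: seq_block_def seq_unblock_def block_index_def)

lemma seq_block_eqI:
  fixes y z :: "int \<Rightarrow> complex ^ 'm"
  assumes "p > 0" "\<And>k i. i \<in> block_index p \<Longrightarrow> seq_block p c y k i = seq_block p c z k i"
  shows "y = z"
proof (rule ext, subst vec_eq_iff, rule allI)
  fix n and \<alpha> :: 'm
  have "((n - c) mod p, \<alpha>) \<in> block_index p" using assms(1) by (auto simp: block_index_def)
  then have "seq_block p c y ((n - c) div p) ((n - c) mod p, \<alpha>) = seq_block p c z ((n - c) div p) ((n - c) mod p, \<alpha>)"
    by (rule assms(2))
  then show "y n $ \<alpha> = z n $ \<alpha>" by (simp add: seq_block_def)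
qed

lemma seq_block_add: "seq_block p c (\<lambda>n. y n + z n) k = (\<lambda>i. seq_block p c y k i + seq_block p c z k i)"
  by (simp add: seq_block_def fun_eq_iff)

lemma seq_block_diff: "seq_block p c (\<lambda>n. y n - z n) k = (\<lambda>i. seq_block p c y k i - seq_block p c z k i)"
  by (simp add: seq_block_def fun_eq_iff)

lemma seq_block_scale: "seq_block p c (\<lambda>n. a *s y n) k = (\<lambda>i. a * seq_block p c y k i)"
  by (simp add: seq_block_def fun_eq_iff)

lemma norm_power2_vec: "(norm x)\<^sup>2 = (\<Sum>\<alpha>\<in>UNIV. (cmod (x $ \<alpha>))\<^sup>2)" for x :: "complex ^ 'm"
  by (simp add: norm_vec_def L2_set_def sum_nonneg)

text \<open>Division with remainder, \<open>n - c = p * k + r\<close>, regroups the sum over sites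
  by blocks; for nonnegative terms summability passes in both directions.\<close>

lemma
  assumes p: "p > 0"
  shows ell2_iff_seq_block: "y \<in> ell2 \<longleftrightarrow> (\<lambda>k. normsq (block_index p) (seq_block p c y k)) summable_on UNIV"
    and has_sum_seq_block: "y \<in> ell2 \<Longrightarrow> ((\<lambda>k. normsq (block_index p) (seq_block p c y k)) has_sum (ell2_norm y)\<^sup>2) UNIV"
proof -
  define h where "h = (\<lambda>(k, r). c + p * k + r)"
  define f where "f n = (norm (y n))\<^sup>2" for n
  have bij: "bij_betw h (UNIV \<times> {0..<p}) UNIV"
    using p by (intro bij_betw_byWitness[where f' = "\<lambda>n. ((n - c) div p, (n - c) mod p)"])
      (auto simp: h_def)
  note reindex = has_sum_reindex_bij_betw[OF bij, of f]
  have inner: "((\<lambda>r. f (h (k, r))) has_sum normsq (block_index p) (seq_block p c y k)) {0..<p}" for k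
  proof (rule has_sum_finiteI)
    show "normsq (block_index p) (seq_block p c y k) = (\<Sum>r\<in>{0..<p}. f (h (k, r)))"
      by (simp add: normsq_def block_index_def f_def norm_power2_vec seq_block_def h_def sum.cartesian_product case_prod_beta)
  qed simp
  have sum: "((\<lambda>k. normsq (block_index p) (seq_block p c y k)) has_sum s) UNIV" if "(f has_sum s) UNIV" for s
    by (rule has_sum_SigmaD[where f = "\<lambda>x. f (h x)" and B = "\<lambda>_. {0..<p}"])
      (use that reindex[of s] inner in auto)
  show "((\<lambda>k. normsq (block_index p) (seq_block p c y k)) has_sum (ell2_norm y)\<^sup>2) UNIV" if "y \<in> ell2"
    using that by (intro sum) (simp add: ell2_norm_power2 ell2_def f_def[abs_def])
  have "f summable_on UNIV" if "(\<lambda>k. normsq (block_index p) (seq_block p c y k)) summable_on UNIV"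
  proof -
    have "(\<lambda>x. f (h x)) summable_on (UNIV \<times> {0..<p})"
      by (rule summable_on_SigmaI[OF inner that]) (simp add: f_def)
    then show ?thesis using reindex unfolding summable_on_def by auto
  qed
  then show "y \<in> ell2 \<longleftrightarrow> (\<lambda>k. normsq (block_index p) (seq_block p c y k)) summable_on UNIV"
    using sum unfolding ell2_def f_def[abs_def] summable_on_def by blast
qed

lemma has_sum_shift_int: "((\<lambda>k. f (k + l)) has_sum s) UNIV \<longleftrightarrow> (f has_sum s) (UNIV :: int set)"
  by (intro has_sum_reindex_bij_betw bij_betwI[where g = "\<lambda>k. k - l"]) auto

text \<open>Shifting the block index does not change the sum of the block norms, so the three
  neighbouring terms give the factor 3.\<close>

lemma ell2_norm_seq_block_le:
  assumes p: "p > 0" and y: "y \<in> ell2" and C: "C \<ge> 0"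
    and le: "\<And>k. normsq (block_index p) (seq_block p c z k) \<le> C * (normsq (block_index p) (seq_block p c y (k - 1)) +
      normsq (block_index p) (seq_block p c y k) + normsq (block_index p) (seq_block p c y (k + 1)))"
  shows "z \<in> ell2" "(ell2_norm z)\<^sup>2 \<le> 3 * C * (ell2_norm y)\<^sup>2"
proof -
  let ?f = "\<lambda>k. normsq (block_index p) (seq_block p c y k)"
  note s = has_sum_seq_block[OF p y, of c]
  have "((\<lambda>k. C * (?f (k - 1) + ?f k + ?f (k + 1))) has_sum
      C * ((ell2_norm y)\<^sup>2 + (ell2_norm y)\<^sup>2 + (ell2_norm y)\<^sup>2)) UNIV"
    using s has_sum_shift_int[of ?f "-1"] has_sum_shift_int[of ?f 1]
    by (intro has_sum_cmult_right has_sum_add) auto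
  then have bound: "((\<lambda>k. C * (?f (k - 1) + ?f k + ?f (k + 1))) has_sum 3 * C * (ell2_norm y)\<^sup>2) UNIV"
    by (simp add: algebra_simps)
  have "(\<lambda>k. normsq (block_index p) (seq_block p c z k)) summable_on UNIV"
    by (rule summable_on_comparison_test[OF has_sum_imp_summable[OF bound] le]) auto
  then show z: "z \<in> ell2" using ell2_iff_seq_block[OF p] by blast
  show "(ell2_norm z)\<^sup>2 \<le> 3 * C * (ell2_norm y)\<^sup>2"
    by (rule has_sum_mono[OF has_sum_seq_block[OF p z, of c] bound]) (rule le)
qed

lemma normsq_add3_le: "normsq I (\<lambda>i. u i + v i + w i) \<le> 4 * (normsq I u + normsq I v + normsq I w)"
  by (rule order_trans[OF normsq_add_le]) (use normsq_add_le[of I u v] normsq_nonneg[of I w] in argo)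

lemma normsq_add3_diff_le: "normsq I (\<lambda>i. u i + v i + w i - z i) \<le> 8 * (normsq I u + normsq I v + normsq I w + normsq I z)"
  by (rule order_trans[OF normsq_diff_le]) (use normsq_add3_le[of I u v w] normsq_nonneg[of I z] in argo)

text \<open>With \<open>G = T - x\<close> and \<open>W\<close> acting as \<open>P\<close> on each
  block, \<open>|v - t W G v|^2\<close> equals
  \<open>|v|^2 - 2 t Re <W G v, v> + t^2 |W G v|^2\<close>. Summing \<open>low\<close> over all
  blocks bounds \<open>Re <W G v, v>\<close> from below by \<open>\<epsilon> |v|^2\<close>, so a
  small \<open>t\<close> gives a contraction.\<close>

lemma block_operator_not_in_spectrum:
  fixes T :: "(int \<Rightarrow> complex ^ 'm) \<Rightarrow> int \<Rightarrow> complex ^ 'm" and p c :: int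
  defines "I \<equiv> block_index p :: (int \<times> 'm) set"
  assumes p: "p > 0"
    and T: "\<And>y k i. i \<in> I \<Longrightarrow> seq_block p c (T y) k i =
      matvec I M (seq_block p c y k) i + matvec I A (seq_block p c y (k + 1)) i + matvec I (\<lambda>i j. cnj (A j i)) (seq_block p c y (k - 1)) i"
    and \<epsilon>: "\<epsilon> > 0"
    and P_inj: "\<And>z. (\<And>i. i \<in> I \<Longrightarrow> matvec I P z i = 0) \<Longrightarrow> \<forall>i\<in>I. z i = 0"
    and low: "\<And>u0 u u1. \<epsilon> * normsq I u + \<theta> u0 u - \<theta> u u1 \<le> Re (inner_on I (matvec I P
       (\<lambda>i. matvec I M u i + matvec I A u1 i + matvec I (\<lambda>i j. cnj (A j i)) u0 i - of_real x * u i)) u)"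
    and \<theta>: "\<And>u0 u. \<bar>\<theta> u0 u\<bar> \<le> C * (normsq I u0 + normsq I u)"
  shows "complex_of_real x \<notin> spectrum T"
proof -
  have finI: "finite I" by (simp add: I_def)
  define B where "B = (\<lambda>(y :: int \<Rightarrow> complex ^ 'm) k. seq_block p c y k)"
  have eqI: "y = z" if "\<And>k i. i \<in> I \<Longrightarrow> B y k i = B z k i" for y z
    using seq_block_eqI[OF p, of c y z] that by (auto simp: B_def I_def)
  have B_lin: "B (\<lambda>n. y n + z n) k = (\<lambda>i. B y k i + B z k i)"
      "B (\<lambda>n. y n - z n) k = (\<lambda>i. B y k i - B z k i)" "B (\<lambda>n. a *s y n) k = (\<lambda>i. a * B y k i)"
    for y z k a by (simp_all add: B_def seq_block_add seq_block_diff seq_block_scale)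
  let ?A' = "\<lambda>i j. cnj (A j i)"
  have T: "B (T y) k i = matvec I M (B y k) i + matvec I A (B y (k + 1)) i + matvec I ?A' (B y (k - 1)) i"
    if "i \<in> I" for y k i using T[OF that] by (simp add: B_def)
  obtain CM where CM: "CM \<ge> 0" "\<And>u. normsq I (matvec I M u) \<le> CM * normsq I u" using normsq_matvec_bounded[of I M] by blast
  obtain CA where CA: "CA \<ge> 0" "\<And>u. normsq I (matvec I A u) \<le> CA * normsq I u" using normsq_matvec_bounded[of I A] by blast
  obtain CA' where CA': "CA' \<ge> 0" "\<And>u. normsq I (matvec I ?A' u) \<le> CA' * normsq I u" using normsq_matvec_bounded[of I ?A'] by blast
  obtain CP where CP: "CP \<ge> 0" "\<And>u. normsq I (matvec I P u) \<le> CP * normsq I u" using normsq_matvec_bounded[of I P] by blast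
  have T_ell2: "T y \<in> ell2" if y: "y \<in> ell2" for y
  proof (rule ell2_norm_seq_block_le[OF p y, where c = c and C = "4 * (CM + CA + CA')"])
    show "0 \<le> 4 * (CM + CA + CA')" using CM CA CA' by simp
    fix k
    let ?prev = "B y (k - 1)" and ?u = "B y k" and ?next = "B y (k + 1)"
    have "normsq I (B (T y) k) = normsq I (\<lambda>i. (matvec I M ?u i + matvec I A ?next i) + matvec I ?A' ?prev i)"
      using T by (intro normsq_cong) auto
    also have "\<dots> \<le> 4 * (normsq I (matvec I M ?u) + normsq I (matvec I A ?next) + normsq I (matvec I ?A' ?prev))"
      by (rule normsq_add3_le)
    also have "\<dots> \<le> 4 * (CM * normsq I ?u + CA * normsq I ?next + CA' * normsq I ?prev)"
      by (intro mult_left_mono add_mono CM CA CA') auto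
    also have "\<dots> \<le> 4 * ((CM + CA + CA') * normsq I ?u + (CM + CA + CA') * normsq I ?next + (CM + CA + CA') * normsq I ?prev)"
      using CM CA CA' by (intro mult_left_mono add_mono mult_right_mono) auto
    finally show "normsq (block_index p) (seq_block p c (T y) k) \<le> 4 * (CM + CA + CA') * (normsq (block_index p) (seq_block p c y (k - 1)) +
      normsq (block_index p) (seq_block p c y k) + normsq (block_index p) (seq_block p c y (k + 1)))"
      by (simp add: B_def I_def algebra_simps)
  qed
  define W where "W y = seq_unblock p c (\<lambda>k. matvec I P (B y k))" for y
  have BW: "B (W y) k i = matvec I P (B y k) i" if "i \<in> I" for y k i
    using that by (simp add: B_def W_def seq_block_seq_unblock I_def)
  have W: "W y \<in> ell2" "(ell2_norm (W y))\<^sup>2 \<le> 3 * CP * (ell2_norm y)\<^sup>2" if y: "y \<in> ell2" for y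
  proof -
    have "normsq (block_index p) (seq_block p c (W y) k) \<le> CP * (normsq (block_index p) (seq_block p c y (k - 1)) +
      normsq (block_index p) (seq_block p c y k) + normsq (block_index p) (seq_block p c y (k + 1)))" for k
    proof -
      have "normsq I (B (W y) k) = normsq I (matvec I P (B y k))" using BW by (intro normsq_cong) auto
      also have "\<dots> \<le> CP * normsq I (B y k)" by (rule CP)
      also have "\<dots> \<le> CP * (normsq I (B y (k - 1)) + normsq I (B y k) + normsq I (B y (k + 1)))"
        using CP by (intro mult_left_mono) auto
      finally show ?thesis by (simp add: B_def I_def)
    qed
    from ell2_norm_seq_block_le[OF p y CP(1) this]
    show "W y \<in> ell2" "(ell2_norm (W y))\<^sup>2 \<le> 3 * CP * (ell2_norm y)\<^sup>2" by auto
  qed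
  have W_bdd: "ell2_norm (W y) \<le> sqrt (3 * CP) * ell2_norm y" if "y \<in> ell2" for y
    using real_sqrt_le_mono[OF W(2)[OF that]] by (simp add: real_sqrt_mult)
  define G where "G y n = T y n - complex_of_real x *s y n" for y n
  have BG: "B (G y) k i = matvec I M (B y k) i + matvec I A (B y (k + 1)) i + matvec I ?A' (B y (k - 1)) i
      - complex_of_real x * B y k i" if "i \<in> I" for y k i
    unfolding G_def[abs_def] B_lin using T[OF that] by simp
  have G_ell2: "G y \<in> ell2" if "y \<in> ell2" for y
    unfolding G_def[abs_def] using T_ell2 that ell2_scale ell2_diff by blast
  obtain K where K: "K \<ge> 0" "\<And>v. v \<in> ell2 \<Longrightarrow> (ell2_norm (W (G v)))\<^sup>2 \<le> K * (ell2_norm v)\<^sup>2"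
  proof -
    define CT where "CT = 8 * (CM + CA + CA' + x\<^sup>2)"
    have CT: "CT \<ge> 0" using CM CA CA' by (simp add: CT_def)
    have "(ell2_norm (G v))\<^sup>2 \<le> 3 * CT * (ell2_norm v)\<^sup>2" if v: "v \<in> ell2" for v
    proof (rule ell2_norm_seq_block_le[OF p v CT, where c = c])
      fix k
      let ?prev = "B v (k - 1)" and ?u = "B v k" and ?next = "B v (k + 1)"
      define D where "D = CM + CA + CA' + x\<^sup>2"
      have "normsq I (B (G v) k) = normsq I (\<lambda>i. ((matvec I M ?u i + matvec I A ?next i) + matvec I ?A' ?prev i) - complex_of_real x * ?u i)"
        using BG by (intro normsq_cong) auto
      also have "\<dots> \<le> 8 * (normsq I (matvec I M ?u) + normsq I (matvec I A ?next) + normsq I (matvec I ?A' ?prev)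
          + normsq I (\<lambda>i. complex_of_real x * ?u i))"
        by (rule normsq_add3_diff_le)
      also have "normsq I (\<lambda>i. complex_of_real x * ?u i) = x\<^sup>2 * normsq I ?u" by (simp add: normsq_scale)
      also have "8 * (normsq I (matvec I M ?u) + normsq I (matvec I A ?next) + normsq I (matvec I ?A' ?prev) + x\<^sup>2 * normsq I ?u)
          \<le> 8 * (CM * normsq I ?u + CA * normsq I ?next + CA' * normsq I ?prev + x\<^sup>2 * normsq I ?u)"
        by (intro mult_left_mono add_mono CM CA CA') auto
      also have "\<dots> = 8 * ((CM * normsq I ?u + x\<^sup>2 * normsq I ?u) + CA * normsq I ?next + CA' * normsq I ?prev)"
        by simp
      also have "CM * normsq I ?u + x\<^sup>2 * normsq I ?u = (CM + x\<^sup>2) * normsq I ?u" by (simp add: distrib_right)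
      also have "8 * ((CM + x\<^sup>2) * normsq I ?u + CA * normsq I ?next + CA' * normsq I ?prev)
          \<le> 8 * (D * normsq I ?u + D * normsq I ?next + D * normsq I ?prev)"
        using CM CA CA' unfolding D_def by (intro mult_left_mono add_mono mult_right_mono) auto
      also have "\<dots> = CT * (normsq I ?prev + normsq I ?u + normsq I ?next)"
        unfolding CT_def D_def[symmetric] by (simp add: algebra_simps)
      finally show "normsq (block_index p) (seq_block p c (G v) k) \<le> CT * (normsq (block_index p) (seq_block p c v (k - 1)) +
      normsq (block_index p) (seq_block p c v k) + normsq (block_index p) (seq_block p c v (k + 1)))"
        by (simp add: B_def I_def)
    qed
    note G_bdd = this
    have "(ell2_norm (W (G v)))\<^sup>2 \<le> (3 * CP * (3 * CT)) * (ell2_norm v)\<^sup>2" if v: "v \<in> ell2" for v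
    proof -
      have "3 * CP * (ell2_norm (G v))\<^sup>2 \<le> 3 * CP * (3 * CT * (ell2_norm v)\<^sup>2)"
        using CP by (intro mult_left_mono G_bdd v) auto
      then show ?thesis using W(2)[OF G_ell2[OF v]] by (simp add: mult.assoc)
    qed
    moreover have "3 * CP * (3 * CT) \<ge> 0" using CP CT by simp
    ultimately show ?thesis using that by blast
  qed
  \<comment> \<open>As \<open>t (K + 1) = \<epsilon>\<close>, the quadratic term
    \<open>t^2 K\<close> is at most \<open>t \<epsilon>\<close>, which leaves the factor
    \<open>1 - t \<epsilon>\<close> for squared norms. The maximum in \<open>r\<close> makes that
    factor nonnegative; the contraction constant is \<open>sqrt r\<close>.\<close>
  define t where "t = \<epsilon> / (K + 1)"
  have t: "t > 0" using \<epsilon> K by (simp add: t_def)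
  define r where "r = max 0 (1 - \<epsilon> * t)"
  have r: "0 \<le> r" "r < 1" using \<epsilon> t by (auto simp: r_def)
  have contr2: "(ell2_norm (\<lambda>n. v n - complex_of_real t *s W (G v) n))\<^sup>2 \<le> r * (ell2_norm v)\<^sup>2"
    if v: "v \<in> ell2" for v
  proof -
    have WG: "W (G v) \<in> ell2" using W G_ell2 v by blast
    define th where "th k = \<theta> (B v (k - 1)) (B v k)" for k
    have sv: "((\<lambda>k. normsq I (B v k)) has_sum (ell2_norm v)\<^sup>2) UNIV"
      using has_sum_seq_block[OF p v, of c] by (simp add: I_def B_def)
    have sz: "((\<lambda>k. normsq I (B (W (G v)) k)) has_sum (ell2_norm (W (G v)))\<^sup>2) UNIV"
      using has_sum_seq_block[OF p WG, of c] by (simp add: I_def B_def)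
    have "((\<lambda>k. normsq I (B v (k - 1))) has_sum (ell2_norm v)\<^sup>2) UNIV"
      using sv has_sum_shift_int[of "\<lambda>k. normsq I (B v k)" "-1"] by simp
    then have "((\<lambda>k. C * (normsq I (B v (k - 1)) + normsq I (B v k))) has_sum
        C * ((ell2_norm v)\<^sup>2 + (ell2_norm v)\<^sup>2)) UNIV"
      by (intro has_sum_cmult_right has_sum_add sv)
    then have bound: "(\<lambda>k. C * (normsq I (B v (k - 1)) + normsq I (B v k))) summable_on UNIV"
      by (rule has_sum_imp_summable)
    have "(\<lambda>k. \<bar>th k\<bar>) summable_on UNIV"
      by (rule summable_on_comparison_test[OF bound]) (simp_all add: th_def \<theta>)
    then have "th summable_on UNIV" using abs_summable_summable[of th UNIV] by simp
    then obtain s where s: "(th has_sum s) UNIV" unfolding summable_on_def by blast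
    \<comment> \<open>The series and its shift have the same sum, so the \<open>\<theta>\<close>
      terms disappear from the total.\<close>
    then have s': "((\<lambda>k. th (k + 1)) has_sum s) UNIV" by (simp add: has_sum_shift_int)
    have pointwise: "normsq I (\<lambda>i. B v k i - complex_of_real t * B (W (G v)) k i) \<le>
        (1 - 2 * t * \<epsilon>) * normsq I (B v k) + t\<^sup>2 * normsq I (B (W (G v)) k) + (- 2 * t) * th k + 2 * t * th (k + 1)" for k
    proof -
      let ?z = "B (W (G v)) k" and ?v = "B v k"
      have "complex_of_real (normsq I (\<lambda>i. ?v i - complex_of_real t * ?z i)) =
          of_real (normsq I ?v) - of_real t * (inner_on I ?z ?v + inner_on I ?v ?z) + of_real (t\<^sup>2) * of_real (normsq I ?z)"
        unfolding inner_on_self[symmetric] inner_on_diff_left inner_on_diff_right inner_on_scale_left inner_on_scale_right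
        by (simp add: algebra_simps power2_eq_square)
      then have "Re (complex_of_real (normsq I (\<lambda>i. ?v i - complex_of_real t * ?z i))) =
          Re (of_real (normsq I ?v) - of_real t * (inner_on I ?z ?v + inner_on I ?v ?z) + of_real (t\<^sup>2) * of_real (normsq I ?z))"
        by simp
      moreover have "Re (inner_on I ?v ?z) = Re (inner_on I ?z ?v)" by (subst inner_on_commute) simp
      ultimately have eq: "normsq I (\<lambda>i. ?v i - complex_of_real t * ?z i) =
          normsq I ?v - 2 * t * Re (inner_on I ?z ?v) + t\<^sup>2 * normsq I ?z"
        by (simp add: algebra_simps)
      let ?g = "\<lambda>i. matvec I M ?v i + matvec I A (B v (k + 1)) i + matvec I ?A' (B v (k - 1)) i - complex_of_real x * ?v i"
      have "inner_on I ?z ?v = inner_on I (matvec I P ?g) ?v"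
        using BG by (intro inner_on_cong) (auto simp: BW intro!: fun_cong[OF matvec_cong])
      then have "\<epsilon> * normsq I ?v + th k - th (k + 1) \<le> Re (inner_on I ?z ?v)"
        using low[of ?v "B v (k - 1)" "B v (k + 1)"] by (simp add: th_def)
      then have "2 * t * (\<epsilon> * normsq I ?v + th k - th (k + 1)) \<le> 2 * t * Re (inner_on I ?z ?v)"
        using t by (intro mult_left_mono) auto
      then show ?thesis unfolding eq by (simp add: algebra_simps)
    qed
    have upper: "((\<lambda>k. (1 - 2 * t * \<epsilon>) * normsq I (B v k) + t\<^sup>2 * normsq I (B (W (G v)) k) + (- 2 * t) * th k + 2 * t * th (k + 1))
      has_sum (1 - 2 * t * \<epsilon>) * (ell2_norm v)\<^sup>2 + t\<^sup>2 * (ell2_norm (W (G v)))\<^sup>2 + (- 2 * t) * s + 2 * t * s) UNIV"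
      by (intro has_sum_add has_sum_cmult_right sv sz s s')
    have lower: "((\<lambda>k. normsq I (\<lambda>i. B v k i - complex_of_real t * B (W (G v)) k i)) has_sum
        (ell2_norm (\<lambda>n. v n - complex_of_real t *s W (G v) n))\<^sup>2) UNIV"
    proof -
      have "seq_block p c (\<lambda>n. v n - complex_of_real t *s W (G v) n) k =
          (\<lambda>i. B v k i - complex_of_real t * B (W (G v)) k i)" for k
        by (simp add: B_def seq_block_diff seq_block_scale)
      then show ?thesis
        using has_sum_seq_block[OF p ell2_diff[OF v ell2_scale[OF WG, of "complex_of_real t"]], of c]
        by (simp only: I_def)
    qed
    have "(ell2_norm (\<lambda>n. v n - complex_of_real t *s W (G v) n))\<^sup>2 \<le>
        (1 - 2 * t * \<epsilon>) * (ell2_norm v)\<^sup>2 + t\<^sup>2 * (ell2_norm (W (G v)))\<^sup>2 + (- 2 * t) * s + 2 * t * s"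
      by (rule has_sum_mono[OF lower upper pointwise])
    also have "\<dots> = (1 - 2 * t * \<epsilon>) * (ell2_norm v)\<^sup>2 + t\<^sup>2 * (ell2_norm (W (G v)))\<^sup>2" by simp
    also have "\<dots> \<le> (1 - 2 * t * \<epsilon>) * (ell2_norm v)\<^sup>2 + t\<^sup>2 * (K * (ell2_norm v)\<^sup>2)"
      using K(2)[OF v] by (intro add_left_mono mult_left_mono) auto
    also have "\<dots> = (1 - 2 * t * \<epsilon> + t * (t * K)) * (ell2_norm v)\<^sup>2"
      by (simp add: algebra_simps power2_eq_square)
    also have "\<dots> \<le> r * (ell2_norm v)\<^sup>2"
    proof (rule mult_right_mono)
      have "t * (K + 1) = \<epsilon>" using K by (simp add: t_def)
      then have "t * K \<le> \<epsilon>" using t by (simp add: algebra_simps)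
      then have "t * (t * K) \<le> t * \<epsilon>" using t by (intro mult_left_mono) auto
      then show "1 - 2 * t * \<epsilon> + t * (t * K) \<le> r" unfolding r_def by (simp add: algebra_simps max_def)
    qed simp
    finally show ?thesis .
  qed
  show ?thesis
  proof (rule preconditioned_contraction_not_in_spectrum[where W = W and t = t and q = "sqrt r" and B = "sqrt (3 * CP)"])
    fix y z :: "int \<Rightarrow> complex ^ 'm"
    show "T (\<lambda>n. y n + z n) = (\<lambda>n. T y n + T z n)"
      by (rule eqI) (simp add: T B_lin matvec_add)
    show "W (\<lambda>n. y n - z n) = (\<lambda>n. W y n - W z n)"
      by (rule eqI) (simp add: BW B_lin matvec_diff)
    show "T (\<lambda>n. a *s y n) = (\<lambda>n. a *s T y n)" for a
      by (rule eqI) (simp add: T B_lin matvec_scale algebra_simps)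
    show "y = (\<lambda>_. 0)" if "W y = (\<lambda>_. 0)"
    proof (rule eqI)
      fix k i assume "i \<in> I"
      have "matvec I P (B y k) i = 0" if "i \<in> I" for i
        using BW[OF that, of y k] \<open>W y = (\<lambda>_. 0)\<close> by (simp add: B_def seq_block_def)
      then have "B y k i = 0" using P_inj[of "B y k"] \<open>i \<in> I\<close> by blast
      then show "B y k i = B (\<lambda>_. 0) k i" by (simp add: B_def seq_block_def)
    qed
    show "ell2_norm (\<lambda>n. y n - of_real t *s W (\<lambda>n. T y n - complex_of_real x *s y n) n) \<le> sqrt r * ell2_norm y"
      if "y \<in> ell2"
      using real_sqrt_le_mono[OF contr2[OF that]] by (simp add: real_sqrt_mult G_def[abs_def])
  qed (use T_ell2 W W_bdd t r in auto)
qed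

subsection \<open>The positive square root\<close>

text \<open>Both expansions insert the resolution of the identity. The first one shows that a matrix
  is determined by its action on the basis.\<close>

lemma
  assumes fin: "finite I"
    and complete: "\<And>i j. i \<in> I \<Longrightarrow> j \<in> I \<Longrightarrow> (\<Sum>k\<in>I. V k i * cnj (V k j)) = of_bool (i = j)"
    and i: "i \<in> I"
  shows complete_basis_matrix: "j \<in> I \<Longrightarrow> M i j = (\<Sum>k\<in>I. matvec I M (V k) i * cnj (V k j))"
    and complete_basis_expand: "u i = (\<Sum>k\<in>I. inner_on I u (V k) * V k i)"
proof -
  have "(\<Sum>k\<in>I. matvec I M (V k) i * cnj (V k j)) = (\<Sum>l\<in>I. M i l * (\<Sum>k\<in>I. V k l * cnj (V k j)))" for j
    unfolding matvec_def sum_distrib_left sum_distrib_right by (subst sum.swap) (simp add: mult.assoc)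
  then show "M i j = (\<Sum>k\<in>I. matvec I M (V k) i * cnj (V k j))" if "j \<in> I"
    using that fin by (simp add: complete)
  have "(\<Sum>k\<in>I. inner_on I u (V k) * V k i) = (\<Sum>l\<in>I. u l * (\<Sum>k\<in>I. V k i * cnj (V k l)))"
    unfolding inner_on_def sum_distrib_left sum_distrib_right by (subst sum.swap) (simp add: mult_ac)
  then show "u i = (\<Sum>k\<in>I. inner_on I u (V k) * V k i)"
    using i fin by (simp add: complete)
qed

lemma trace_eq_sum_eigenvalues:
  fixes V :: "'i \<Rightarrow> 'i \<Rightarrow> complex" and d :: "'i \<Rightarrow> real"
  assumes "finite I"
    and orth: "\<And>k l. k \<in> I \<Longrightarrow> l \<in> I \<Longrightarrow> inner_on I (V k) (V l) = of_bool (k = l)"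
    and eig: "\<And>k i. k \<in> I \<Longrightarrow> i \<in> I \<Longrightarrow> matvec I M (V k) i = d k * V k i"
    and complete: "\<And>i j. i \<in> I \<Longrightarrow> j \<in> I \<Longrightarrow> (\<Sum>k\<in>I. V k i * cnj (V k j)) = of_bool (i = j)"
  shows "(\<Sum>i\<in>I. M i i) = of_real (\<Sum>k\<in>I. d k)"
proof -
  have "(\<Sum>i\<in>I. M i i) = (\<Sum>i\<in>I. \<Sum>k\<in>I. d k * (V k i * cnj (V k i)))"
  proof (rule sum.cong)
    fix i assume "i \<in> I"
    then have "M i i = (\<Sum>k\<in>I. matvec I M (V k) i * cnj (V k i))"
      by (intro complete_basis_matrix[OF assms(1) complete]) auto
    also have "\<dots> = (\<Sum>k\<in>I. d k * (V k i * cnj (V k i)))"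
      using eig \<open>i \<in> I\<close> by (intro sum.cong) (auto simp: mult.assoc)
    finally show "M i i = (\<Sum>k\<in>I. d k * (V k i * cnj (V k i)))" .
  qed simp
  also have "\<dots> = (\<Sum>k\<in>I. d k * inner_on I (V k) (V k))"
    unfolding inner_on_def sum_distrib_left by (rule sum.swap)
  also have "\<dots> = of_real (\<Sum>k\<in>I. d k)" using orth by simp
  finally show ?thesis .
qed

lemma
  fixes c :: "'k \<Rightarrow> real" and w :: "'k \<Rightarrow> 'i \<Rightarrow> complex"
  shows matvec_rank_one_sum: "matvec I (\<lambda>i j. \<Sum>k\<in>K. c k * (w k i * cnj (w k j))) u i = (\<Sum>k\<in>K. c k * (inner_on I u (w k) * w k i))"
    and quad_form_rank_one_sum: "quad_form I (\<lambda>i j. \<Sum>k\<in>K. c k * (w k i * cnj (w k j))) u = (\<Sum>k\<in>K. c k * (cmod (inner_on I u (w k)))\<^sup>2)"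
    and hermitian_rank_one_sum: "hermitian_on I (\<lambda>i j. \<Sum>k\<in>K. c k * (w k i * cnj (w k j)))"
proof -
  show matvec: "matvec I (\<lambda>i j. \<Sum>k\<in>K. c k * (w k i * cnj (w k j))) u i = (\<Sum>k\<in>K. c k * (inner_on I u (w k) * w k i))" for i
    unfolding matvec_def inner_on_def sum_distrib_left sum_distrib_right by (subst sum.swap) (simp add: mult_ac)
  have "inner_on I (matvec I (\<lambda>i j. \<Sum>k\<in>K. c k * (w k i * cnj (w k j))) u) u
      = inner_on I (\<lambda>i. \<Sum>k\<in>K. (c k * inner_on I u (w k)) * w k i) u"
    by (intro inner_on_cong) (simp_all add: matvec mult.assoc)
  also have "\<dots> = (\<Sum>k\<in>K. c k * (inner_on I u (w k) * cnj (inner_on I u (w k))))"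
    unfolding inner_on_lincomb_left by (intro sum.cong refl) (subst (2) inner_on_commute, simp)
  also have "\<dots> = complex_of_real (\<Sum>k\<in>K. c k * (cmod (inner_on I u (w k)))\<^sup>2)"
    by (simp add: complex_norm_square del: of_real_power)
  finally show "quad_form I (\<lambda>i j. \<Sum>k\<in>K. c k * (w k i * cnj (w k j))) u = (\<Sum>k\<in>K. c k * (cmod (inner_on I u (w k)))\<^sup>2)"
    unfolding quad_form_def by (simp only: Re_complex_of_real)
  show "hermitian_on I (\<lambda>i j. \<Sum>k\<in>K. c k * (w k i * cnj (w k j)))"
    by (simp add: hermitian_on_def mult_ac)
qed

section \<open>Positive square roots and singular values\<close>

abbreviation mat_fun :: "complex ^ 'm ^ 'm \<Rightarrow> 'm \<Rightarrow> 'm \<Rightarrow> complex" where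
  "mat_fun A \<equiv> \<lambda>i j. A $ i $ j"

lemma matrix_vector_mult_matvec: "(A *v x) $ i = matvec UNIV (mat_fun A) (\<lambda>j. x $ j) i"
  by (simp add: matrix_vector_mult_def matvec_def)

lemma conj_transpose_eq_iff_hermitian: "conj_transpose A = A \<longleftrightarrow> hermitian_on UNIV (mat_fun A)"
proof -
  have "conj_transpose A = A \<longleftrightarrow> (\<forall>i j. cnj (A $ j $ i) = A $ i $ j)"
    by (simp add: conj_transpose_def vec_eq_iff)
  also have "\<dots> \<longleftrightarrow> (\<forall>i j. A $ j $ i = cnj (A $ i $ j))" by metis
  finally show ?thesis by (simp only: hermitian_on_def ball_UNIV)
qed

lemma pos_semidef_iff:
  fixes A :: "complex ^ 'm ^ 'm"
  shows "pos_semidef A \<longleftrightarrow> hermitian_on UNIV (mat_fun A) \<and> (\<forall>u. 0 \<le> quad_form UNIV (mat_fun A) u)"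
proof -
  have "(\<Sum>i\<in>UNIV. cnj (x $ i) * (A *v x) $ i) = inner_on UNIV (matvec UNIV (mat_fun A) (\<lambda>j. x $ j)) (\<lambda>j. x $ j)" for x
    by (simp add: inner_on_def matrix_vector_mult_matvec mult.commute)
  then have "(\<forall>x. 0 \<le> Re (\<Sum>i\<in>UNIV. cnj (x $ i) * (A *v x) $ i)) \<longleftrightarrow> (\<forall>x. 0 \<le> quad_form UNIV (mat_fun A) (\<lambda>j. x $ j))"
    by (simp add: quad_form_def)
  also have "\<dots> \<longleftrightarrow> (\<forall>u. 0 \<le> quad_form UNIV (mat_fun A) u)"
  proof (intro iffI allI)
    fix u :: "'m \<Rightarrow> complex" assume *: "\<forall>x. 0 \<le> quad_form UNIV (mat_fun A) (\<lambda>j. x $ j)"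
    have "($) (\<chi> j. u j) = u" by (rule ext) simp
    then show "0 \<le> quad_form UNIV (mat_fun A) u" using *[rule_format, of "\<chi> j. u j"] by (simp only:)
  qed simp
  finally show ?thesis by (simp add: pos_semidef_def conj_transpose_eq_iff_hermitian)
qed

lemma mat_fun_mult: "matvec UNIV (mat_fun (A ** B)) u = matvec UNIV (mat_fun A) (matvec UNIV (mat_fun B) u)"
proof
  fix i
  show "matvec UNIV (mat_fun (A ** B)) u i = matvec UNIV (mat_fun A) (matvec UNIV (mat_fun B) u) i"
    unfolding matvec_def matrix_matrix_mult_def
    by (simp add: sum_distrib_left sum_distrib_right mult.assoc) (rule sum.swap)
qed

lemma mat_fun_conj_transpose: "mat_fun (conj_transpose A) = (\<lambda>i j. cnj (A $ j $ i))"
  by (simp add: conj_transpose_def)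

text \<open>\<open>V\<close> diagonalises \<open>a^* a\<close>, and the \<open>s k\<close> are the
  singular values of \<open>a\<close>. To evaluate the definite description, every positive root has
  to be compared with the spectral one; testing on the vectors \<open>V k\<close> avoids
  diagonalising the other root.\<close>

lemma psd_sqrt_gram:
  fixes a :: "complex ^ 'm ^ 'm"
  obtains V :: "'m \<Rightarrow> 'm \<Rightarrow> complex" and s :: "'m \<Rightarrow> real" where
    "\<And>k l. inner_on UNIV (V k) (V l) = of_bool (k = l)"
    "\<And>i j. (\<Sum>k\<in>UNIV. V k i * cnj (V k j)) = of_bool (i = j)"
    "\<And>k. s k \<ge> 0" "\<And>k. normsq UNIV (matvec UNIV (mat_fun a) (V k)) = (s k)\<^sup>2"
    "\<And>i j. psd_sqrt (conj_transpose a ** a) $ i $ j = (\<Sum>k\<in>UNIV. s k * (V k i * cnj (V k j)))"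
proof -
  define H where "H = conj_transpose a ** a"
  have mvH: "matvec UNIV (mat_fun H) u = matvec UNIV (\<lambda>i j. cnj (a $ j $ i)) (matvec UNIV (mat_fun a) u)" for u
    by (simp add: H_def mat_fun_mult mat_fun_conj_transpose)
  have "hermitian_on UNIV (mat_fun H)"
    by (simp add: hermitian_on_def H_def matrix_matrix_mult_def conj_transpose_def mult.commute)
  from hermitian_spectral[OF finite this] obtain V :: "'m \<Rightarrow> 'm \<Rightarrow> complex" and d :: "'m \<Rightarrow> real" where
    V0: "\<And>k l. k \<in> UNIV \<Longrightarrow> l \<in> UNIV \<Longrightarrow> inner_on UNIV (V k) (V l) = of_bool (k = l)"
    "\<And>k i. k \<in> UNIV \<Longrightarrow> i \<in> UNIV \<Longrightarrow> matvec UNIV (mat_fun H) (V k) i = d k * V k i"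
    "\<And>i j. i \<in> UNIV \<Longrightarrow> j \<in> UNIV \<Longrightarrow> (\<Sum>k\<in>UNIV. V k i * cnj (V k j)) = of_bool (i = j)" by blast
  note V = V0[OF UNIV_I UNIV_I]
  have HV: "matvec UNIV (mat_fun H) (V k) = (\<lambda>i. d k * V k i)" for k using V(2) by (simp add: fun_eq_iff)
  have d: "normsq UNIV (matvec UNIV (mat_fun a) (V k)) = d k" for k
  proof -
    have "complex_of_real (normsq UNIV (matvec UNIV (mat_fun a) (V k))) = inner_on UNIV (V k) (matvec UNIV (mat_fun H) (V k))"
      unfolding inner_on_self[symmetric] by (subst inner_on_matvec_adjoint) (simp add: mvH)
    also have "\<dots> = of_real (d k)" unfolding HV inner_on_scale_right by (simp add: V(1))
    finally show ?thesis by (simp only: of_real_eq_iff)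
  qed
  define s where "s k = sqrt (d k)" for k
  have d0: "d k \<ge> 0" for k using d[of k] normsq_nonneg by metis
  then have s: "s k \<ge> 0" "(s k)\<^sup>2 = d k" for k by (auto simp: s_def)
  define B where "B = (\<chi> i j. \<Sum>k\<in>UNIV. s k * (V k i * cnj (V k j)))"
  have B_fun: "mat_fun B = (\<lambda>i j. \<Sum>k\<in>UNIV. s k * (V k i * cnj (V k j)))" by (simp add: B_def)
  \<comment> \<open>From here on \<open>ext\<close> is this local fact, so \<open>rule ext\<close>
    below reduces an equation of matrices to the basis vectors \<open>V k\<close>.\<close>
  have ext: "M = N" if "\<And>k. matvec UNIV (mat_fun M) (V k) = matvec UNIV (mat_fun N) (V k)" for M N
  proof -
    have "M $ i $ j = N $ i $ j" for i j
      using complete_basis_matrix[OF finite V(3) UNIV_I UNIV_I, of "mat_fun M" i j]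
        complete_basis_matrix[OF finite V(3) UNIV_I UNIV_I, of "mat_fun N" i j]
      unfolding that by (rule trans[OF _ sym])
    then show ?thesis by (simp add: vec_eq_iff)
  qed
  have BV: "matvec UNIV (mat_fun B) (V k) = (\<lambda>i. s k * V k i)" for k
  proof
    fix i
    have "matvec UNIV (mat_fun B) (V k) i = (\<Sum>l\<in>UNIV. s l * (of_bool (k = l) * V l i))"
      unfolding B_fun matvec_rank_one_sum by (simp add: V(1))
    also have "\<dots> = (\<Sum>l\<in>UNIV. if l = k then s l * V l i else 0)" by (intro sum.cong) auto
    finally show "matvec UNIV (mat_fun B) (V k) i = s k * V k i" by simp
  qed
  have "psd_sqrt H = B"
    unfolding psd_sqrt_def
  proof (rule the_equality, intro conjI)
    show "pos_semidef B"
      unfolding pos_semidef_iff B_fun quad_form_rank_one_sum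
      using hermitian_rank_one_sum s by (auto intro!: sum_nonneg)
    show "B ** B = H"
      by (rule ext) (simp add: mat_fun_mult BV matvec_scale HV s(2)[symmetric] power2_eq_square mult.assoc)
  next
    fix C assume C: "pos_semidef C \<and> C ** C = H"
    then have herm: "hermitian_on UNIV (mat_fun C)" and pos: "\<And>u. 0 \<le> quad_form UNIV (mat_fun C) u"
      by (auto simp: pos_semidef_iff)
    have CC: "matvec UNIV (mat_fun C) (matvec UNIV (mat_fun C) u) = matvec UNIV (mat_fun H) u" for u
      using C by (metis mat_fun_mult)
    show "C = B"
    proof (rule ext)
      fix k
      \<comment> \<open>\<open>u = (C - s k) V k\<close> satisfies \<open>C u = - s k u\<close>,
        because \<open>C ** C\<close> acts on \<open>V k\<close> as \<open>(s k)\<^sup>2\<close>. If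
        \<open>s k > 0\<close>, positivity of \<open>C\<close> forces \<open>u = 0\<close>; if
        \<open>s k = 0\<close>, the norm of \<open>u = C (V k)\<close> is read off from
        \<open>H\<close>.\<close>
      define u where "u i = matvec UNIV (mat_fun C) (V k) i - s k * V k i" for i
      have "normsq UNIV u = 0"
      proof (cases "s k = 0")
        case True
        then have "u = matvec UNIV (mat_fun C) (V k)" by (simp add: u_def fun_eq_iff)
        then have "complex_of_real (normsq UNIV u) = inner_on UNIV (V k) (matvec UNIV (mat_fun H) (V k))"
          unfolding inner_on_self[symmetric] by (simp add: inner_on_matvec_hermitian[OF herm] CC)
        also have "\<dots> = 0" using True s(2)[of k] by (simp add: HV inner_on_def)
        finally show ?thesis by simp
      next
        case False
        have "matvec UNIV (mat_fun C) u = (\<lambda>i. (- s k) * u i)"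
          unfolding u_def[abs_def] matvec_diff matvec_scale CC HV
          by (simp add: fun_eq_iff algebra_simps power2_eq_square flip: s(2))
        then have "inner_on UNIV (matvec UNIV (mat_fun C) u) u = of_real (- s k * normsq UNIV u)"
          by (simp only: inner_on_scale_left inner_on_self of_real_mult of_real_minus)
        then have "0 \<le> - s k * normsq UNIV u"
          using pos[of u] unfolding quad_form_def by (simp only: Re_complex_of_real)
        then show ?thesis using False s(1)[of k] normsq_nonneg[of UNIV u]
          by (metis antisym_conv1 less_eq_real_def mult_minus_left mult_pos_pos neg_0_le_iff_le not_le)
      qed
      then have "u i = 0" for i by (simp add: normsq_eq_0_iff)
      then show "matvec UNIV (mat_fun C) (V k) = matvec UNIV (mat_fun B) (V k)"
        unfolding BV by (simp add: u_def fun_eq_iff)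
    qed
  qed
  then show ?thesis using that[of V s] V(1,3) s d B_fun by (auto simp: H_def fun_eq_iff)
qed

text \<open>\<open>Q\<close> is \<open>(a a\<^sup>*)\<^sup>1\<^sup>/\<^sup>2\<close>, written through the singular values \<open>s k\<close> of \<open>a\<close>; vanishing ones do not
  contribute because \<open>inverse 0 = 0\<close>.\<close>

lemma psd_sqrt_dominates:
  fixes a :: "complex ^ 'm ^ 'm"
  defines "R \<equiv> psd_sqrt (conj_transpose a ** a)"
  obtains Q :: "'m \<Rightarrow> 'm \<Rightarrow> complex" where
    "hermitian_on UNIV (mat_fun R)" "hermitian_on UNIV Q" "(\<Sum>i\<in>UNIV. Q i i) = trace R"
    "\<And>u w. 2 * \<bar>Re (inner_on UNIV (matvec UNIV (mat_fun a) w) u)\<bar> \<le> quad_form UNIV (mat_fun R) w + quad_form UNIV Q u"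
proof -
  obtain V :: "'m \<Rightarrow> 'm \<Rightarrow> complex" and s :: "'m \<Rightarrow> real" where
    V: "\<And>k l. inner_on UNIV (V k) (V l) = of_bool (k = l)"
    "\<And>i j. (\<Sum>k\<in>UNIV. V k i * cnj (V k j)) = of_bool (i = j)"
    and s: "\<And>k. s k \<ge> 0" "\<And>k. normsq UNIV (matvec UNIV (mat_fun a) (V k)) = (s k)\<^sup>2"
    and R: "\<And>i j. R $ i $ j = (\<Sum>k\<in>UNIV. s k * (V k i * cnj (V k j)))"
    unfolding R_def using psd_sqrt_gram[of a] by blast
  define w where "w k = matvec UNIV (mat_fun a) (V k)" for k
  define Q where "Q i j = (\<Sum>k\<in>UNIV. inverse (s k) * (w k i * cnj (w k j)))" for i j
  have normsq_trace: "(\<Sum>i\<in>UNIV. \<Sum>k\<in>UNIV. complex_of_real (c k) * (v k i * cnj (v k i))) =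
      (\<Sum>k\<in>UNIV. of_real (c k * normsq UNIV (v k)))" for c and v :: "'m \<Rightarrow> 'm \<Rightarrow> complex"
    by (subst sum.swap) (simp add: inner_on_self[symmetric] inner_on_def sum_distrib_left)
  have "normsq UNIV (V k) = 1" for k using V(1)[of k k] by (simp add: inner_on_self)
  then have "trace R = (\<Sum>k\<in>UNIV. of_real (s k))" unfolding trace_def R normsq_trace by simp
  moreover have "(\<Sum>i\<in>UNIV. Q i i) = (\<Sum>k\<in>UNIV. of_real (s k))"
  proof -
    \<comment> \<open>\<open>w k\<close> has squared norm \<open>(s k)\<^sup>2\<close>, so both
      traces are the sum of the singular values.\<close>
    have "inverse (s k) * normsq UNIV (w k) = s k" for k
      unfolding w_def s(2) by (cases "s k = 0") (auto simp: power2_eq_square)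
    then show ?thesis unfolding Q_def normsq_trace by simp
  qed
  moreover have "2 * \<bar>Re (inner_on UNIV (matvec UNIV (mat_fun a) v) u)\<bar> \<le> quad_form UNIV (mat_fun R) v + quad_form UNIV Q u" for u v
  proof -
    let ?\<alpha> = "\<lambda>k. inner_on UNIV v (V k)" and ?\<beta> = "\<lambda>k. inner_on UNIV (w k) u"
    have "v = (\<lambda>i. \<Sum>k\<in>UNIV. ?\<alpha> k * V k i)"
      by (rule ext) (rule complete_basis_expand[OF finite V(2) UNIV_I])
    then have "matvec UNIV (mat_fun a) v = matvec UNIV (mat_fun a) (\<lambda>i. \<Sum>k\<in>UNIV. ?\<alpha> k * V k i)"
      by (rule arg_cong)
    also have "\<dots> = (\<lambda>i. \<Sum>k\<in>UNIV. ?\<alpha> k * w k i)"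
      unfolding w_def by (rule ext) (rule matvec_lincomb)
    finally have "matvec UNIV (mat_fun a) v = (\<lambda>i. \<Sum>k\<in>UNIV. ?\<alpha> k * w k i)" .
    then have inner_on_eq: "inner_on UNIV (matvec UNIV (mat_fun a) v) u = (\<Sum>k\<in>UNIV. ?\<alpha> k * ?\<beta> k)"
      by (simp only: inner_on_lincomb_left)
    have "2 * \<bar>Re (inner_on UNIV (matvec UNIV (mat_fun a) v) u)\<bar> \<le> 2 * cmod (\<Sum>k\<in>UNIV. ?\<alpha> k * ?\<beta> k)"
      unfolding inner_on_eq by (intro mult_left_mono abs_Re_le_cmod) simp
    also have "\<dots> \<le> 2 * (\<Sum>k\<in>UNIV. cmod (?\<alpha> k * ?\<beta> k))"
      by (intro mult_left_mono norm_sum) auto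
    also have "\<dots> = (\<Sum>k\<in>UNIV. 2 * cmod (?\<alpha> k) * cmod (?\<beta> k))"
      by (simp add: sum_distrib_left norm_mult mult.assoc)
    \<comment> \<open>The arithmetic-geometric inequality with weight \<open>s k\<close> divides
      each product between the two forms. If \<open>s k = 0\<close>, then \<open>w k = 0\<close> and
      the product vanishes, in agreement with \<open>inverse 0 = 0\<close>.\<close>
    also have "\<dots> \<le> (\<Sum>k\<in>UNIV. s k * (cmod (?\<alpha> k))\<^sup>2 + inverse (s k) * (cmod (?\<beta> k))\<^sup>2)"
    proof (rule sum_mono)
      fix k
      show "2 * cmod (?\<alpha> k) * cmod (?\<beta> k) \<le> s k * (cmod (?\<alpha> k))\<^sup>2 + inverse (s k) * (cmod (?\<beta> k))\<^sup>2"
      proof (cases "s k = 0")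
        case True
        then have "normsq UNIV (w k) = 0" using s(2)[of k] by (simp add: w_def)
        then have "w k i = 0" for i by (simp add: normsq_eq_0_iff)
        then have "?\<beta> k = 0" by (simp add: inner_on_def)
        then show ?thesis by (simp add: True)
      next
        case False
        then have sk: "s k > 0" using s(1)[of k] by simp
        have "0 \<le> (s k * cmod (?\<alpha> k) - cmod (?\<beta> k))\<^sup>2 / s k" using sk by simp
        also have "\<dots> = s k * (cmod (?\<alpha> k))\<^sup>2 + inverse (s k) * (cmod (?\<beta> k))\<^sup>2 - 2 * cmod (?\<alpha> k) * cmod (?\<beta> k)"
          using sk by (simp add: power2_eq_square field_simps)
        finally show ?thesis by simp
      qed
    qed
    also have "\<dots> = quad_form UNIV (mat_fun R) v + quad_form UNIV Q u"
    proof -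
      have "cmod (inner_on UNIV u (w k)) = cmod (?\<beta> k)" for k by (subst inner_on_commute) simp
      then show ?thesis unfolding R Q_def[abs_def] quad_form_rank_one_sum by (simp add: sum.distrib)
    qed
    finally show ?thesis .
  qed
  moreover have "hermitian_on UNIV (mat_fun R)" "hermitian_on UNIV Q"
    unfolding R Q_def[abs_def] by (rule hermitian_rank_one_sum)+
  ultimately show ?thesis using that[of Q] by simp
qed

subsection \<open>The measure of the spectrum\<close>

text \<open>Sums of eigenvalues are areas under counting functions: the count for \<open>d\<close>
  minus the count for \<open>d'\<close> has integral
  \<open>(\<Sum>k\<in>I. d' k) - (\<Sum>k\<in>I. d k)\<close>. Counts are integers, so on
  \<open>S\<close>, away from the finitely many eigenvalues, the difference is at least 1.\<close>

lemma emeasure_eigenvalue_count_le: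
  fixes d d' :: "'i \<Rightarrow> real"
  assumes fin: "finite I"
    and S: "\<And>x. x \<in> S \<Longrightarrow> (\<forall>k\<in>I. d k \<noteq> x \<and> d' k \<noteq> x) \<Longrightarrow> card {k\<in>I. d' k < x} < card {k\<in>I. d k < x}"
    and le: "\<And>x. (\<forall>k\<in>I. d k \<noteq> x \<and> d' k \<noteq> x) \<Longrightarrow> card {k\<in>I. d' k < x} \<le> card {k\<in>I. d k < x}"
  shows "emeasure lborel S \<le> ennreal ((\<Sum>k\<in>I. d' k) - (\<Sum>k\<in>I. d k))"
proof -
  define E where "E = d ` I \<union> d' ` I"
  have E: "finite E" using fin by (simp add: E_def)
  have notE: "\<forall>k\<in>I. d k \<noteq> x \<and> d' k \<noteq> x" if "x \<notin> E" for x using that by (auto simp: E_def)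
  \<comment> \<open>Beyond \<open>R\<close> both counts equal \<open>card I\<close>, so truncating
    there keeps their difference and makes both integrals finite. Inserting 0 covers an empty
    \<open>I\<close>.\<close>
  define R where "R = Max (insert 0 E)"
  have R: "d k \<le> R" "d' k \<le> R" if "k \<in> I" for k
    using E that unfolding R_def by (auto intro!: Max_ge simp: E_def)
  define cnt where "cnt c x = (\<Sum>k\<in>I. indicator {c k<..R} x :: real)" for c :: "'i \<Rightarrow> real" and x
  have cnt: "cnt c x = real (card {k\<in>I. c k < x})" if "x \<le> R" for c x
  proof -
    have "cnt c x = (\<Sum>k\<in>I. if c k < x then 1 else 0)"
      unfolding cnt_def using that by (intro sum.cong) (auto simp: indicator_def)
    also have "\<dots> = real (card {k\<in>I. c k < x})" using fin by (simp add: sum.If_cases Int_def)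
    finally show ?thesis .
  qed
  have cnt_R: "cnt c x = 0" if "x > R" for c x using that by (simp add: cnt_def)
  have cnt_le: "cnt d' x \<le> cnt d x" if "x \<notin> E" for x
    using le[OF notE[OF that]] cnt cnt_R by (cases "x \<le> R") auto
  have [measurable]: "cnt c \<in> borel_measurable borel" for c
    unfolding cnt_def[abs_def] by measurable
  define B where "B = {x. cnt d' x + 1 \<le> cnt d x}"
  have B_meas [measurable]: "B \<in> sets borel" unfolding B_def by measurable
  have "S \<subseteq> B \<union> E"
  proof
    fix x assume x: "x \<in> S"
    show "x \<in> B \<union> E"
    proof (cases "x \<in> E")
      case False
      from S[OF x notE[OF False]] have lt: "card {k\<in>I. d' k < x} < card {k\<in>I. d k < x}" .
      have "x \<le> R"
      proof (rule ccontr)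
        assume "\<not> x \<le> R"
        then have "{k\<in>I. d' k < x} = I" "{k\<in>I. d k < x} = I" using R by fastforce+
        with lt show False by simp
      qed
      then show ?thesis using lt cnt by (simp add: B_def)
    qed simp
  qed
  \<comment> \<open>\<open>B \<union> E\<close> is a Borel set, as monotonicity of
    \<open>emeasure\<close> demands of the larger side.\<close>
  then have "emeasure lborel S \<le> emeasure lborel (B \<union> E)"
    using E by (intro emeasure_mono) (auto simp: finite_imp_closed borel_closed)
  also have "\<dots> \<le> emeasure lborel B + emeasure lborel E"
    using E by (intro emeasure_subadditive) (auto simp: finite_imp_closed borel_closed)
  also have "emeasure lborel E = 0" using E by (intro emeasure_lborel_countable countable_finite)
  finally have SB: "emeasure lborel S \<le> emeasure lborel B" by simp
  have int: "(\<integral>\<^sup>+x. ennreal (cnt c x) \<partial>lborel) = ennreal (\<Sum>k\<in>I. R - c k)" if "\<And>k. k \<in> I \<Longrightarrow> c k \<le> R" for c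
  proof -
    have "(\<integral>\<^sup>+x. ennreal (cnt c x) \<partial>lborel) = (\<integral>\<^sup>+x. (\<Sum>k\<in>I. indicator {c k<..R} x) \<partial>lborel)"
      unfolding cnt_def by (intro nn_integral_cong) (simp add: sum_ennreal[symmetric] ennreal_indicator)
    also have "\<dots> = (\<Sum>k\<in>I. \<integral>\<^sup>+x. indicator {c k<..R} x \<partial>lborel)"
      by (rule nn_integral_sum) simp
    also have "\<dots> = (\<Sum>k\<in>I. ennreal (R - c k))"
      using that by (intro sum.cong) auto
    also have "\<dots> = ennreal (\<Sum>k\<in>I. R - c k)" using that by (intro sum_ennreal) auto
    finally show ?thesis .
  qed
  have "AE x in lborel. x \<notin> E"
    using E by (intro AE_not_in) (auto simp: null_sets_def finite_imp_closed borel_closed emeasure_lborel_countable countable_finite)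
  then have "AE x in lborel. indicator B x + ennreal (cnt d' x) \<le> ennreal (cnt d x)"
  proof eventually_elim
    case (elim x)
    have "cnt d' x \<ge> 0" by (simp add: cnt_def sum_nonneg)
    have "indicator B x + ennreal (cnt d' x) = ennreal (indicator B x + cnt d' x)"
      using \<open>cnt d' x \<ge> 0\<close> by (simp add: ennreal_plus ennreal_indicator)
    also have "\<dots> \<le> ennreal (cnt d x)"
      using cnt_le[OF elim] by (intro ennreal_leI) (auto simp: B_def indicator_def)
    finally show ?case .
  qed
  then have "(\<integral>\<^sup>+x. indicator B x + ennreal (cnt d' x) \<partial>lborel) \<le> (\<integral>\<^sup>+x. ennreal (cnt d x) \<partial>lborel)"
    by (rule nn_integral_mono_AE)
  then have "emeasure lborel B + ennreal (\<Sum>k\<in>I. R - d' k) \<le> ennreal (\<Sum>k\<in>I. R - d k)"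
    by (simp add: nn_integral_add int R)
  then have "emeasure lborel B \<le> ennreal (\<Sum>k\<in>I. R - d k) - ennreal (\<Sum>k\<in>I. R - d' k)"
    by (rule ennreal_le_minus_iff[THEN iffD2, OF disjI1, rotated])
  also have "\<dots> = ennreal ((\<Sum>k\<in>I. R - d k) - (\<Sum>k\<in>I. R - d' k))"
    using R by (intro ennreal_minus sum_nonneg) auto
  also have "(\<Sum>k\<in>I. R - d k) - (\<Sum>k\<in>I. R - d' k) = (\<Sum>k\<in>I. d' k) - (\<Sum>k\<in>I. d k)"
    by (simp add: sum_subtractf)
  finally show ?thesis using SB by (rule order_trans[rotated])
qed

section \<open>Matrices with one nonzero block in each row or in total\<close>

definition band_matrix :: "(int \<Rightarrow> int) \<Rightarrow> (int \<Rightarrow> 'm \<Rightarrow> 'm \<Rightarrow> complex) \<Rightarrow> int \<times> 'm \<Rightarrow> int \<times> 'm \<Rightarrow> complex" where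
  "band_matrix g X i j = (if fst j = g (fst i) then X (fst i) (snd i) (snd j) else 0)"

text \<open>The target \<open>g (fst i)\<close> may leave the period. The row then gives 0, and the
  missing coupling has to come from the adjacent block.\<close>

lemma matvec_band_matrix:
  "matvec (block_index p) (band_matrix g X) u i =
    (if g (fst i) \<in> {0..<p} then matvec UNIV (X (fst i)) (\<lambda>\<beta>. u (g (fst i), \<beta>)) (snd i) else 0)"
proof -
  have "matvec (block_index p) (band_matrix g X) u i =
      (\<Sum>r\<in>{0..<p}. \<Sum>\<beta>\<in>UNIV. band_matrix g X i (r, \<beta>) * u (r, \<beta>))"
    unfolding matvec_def block_index_def by (simp add: sum.cartesian_product)
  also have "\<dots> = (\<Sum>r\<in>{0..<p}. if g (fst i) = r then matvec UNIV (X (fst i)) (\<lambda>\<beta>. u (g (fst i), \<beta>)) (snd i) else 0)"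
    by (intro sum.cong) (auto simp: band_matrix_def matvec_def)
  finally show ?thesis by simp
qed

lemma inner_on_block_index:
  "inner_on (block_index p) u v = (\<Sum>r\<in>{0..<p}. inner_on UNIV (\<lambda>\<beta>. u (r, \<beta>)) (\<lambda>\<beta>. v (r, \<beta>)))"
  unfolding inner_on_def block_index_def by (simp add: sum.cartesian_product)

definition corner_matrix :: "int \<Rightarrow> int \<Rightarrow> ('m \<Rightarrow> 'm \<Rightarrow> complex) \<Rightarrow> int \<times> 'm \<Rightarrow> int \<times> 'm \<Rightarrow> complex" where
  "corner_matrix r s X = band_matrix (\<lambda>_. s) (\<lambda>t. if t = r then X else (\<lambda>_ _. 0))"

lemma corner_matrix_eq: "corner_matrix r s X i j = (if fst i = r \<and> fst j = s then X (snd i) (snd j) else 0)"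
  by (simp add: corner_matrix_def band_matrix_def)

lemma matvec_corner_matrix:
  "s \<in> {0..<p} \<Longrightarrow> matvec (block_index p) (corner_matrix r s X) u i =
    (if fst i = r then matvec UNIV X (\<lambda>\<beta>. u (s, \<beta>)) (snd i) else 0)"
  unfolding corner_matrix_def matvec_band_matrix by (simp add: matvec_def)

lemma inner_on_corner_matrix:
  assumes "r \<in> {0..<p}" "s \<in> {0..<p}"
  shows "inner_on (block_index p) (matvec (block_index p) (corner_matrix r s X) u) v =
    inner_on UNIV (matvec UNIV X (\<lambda>\<beta>. u (s, \<beta>))) (\<lambda>\<beta>. v (r, \<beta>))"
proof -
  have "inner_on (block_index p) (matvec (block_index p) (corner_matrix r s X) u) v =
      (\<Sum>t\<in>{0..<p}. if t = r then inner_on UNIV (matvec UNIV X (\<lambda>\<beta>. u (s, \<beta>))) (\<lambda>\<beta>. v (r, \<beta>)) else 0)"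
    unfolding inner_on_block_index using assms by (intro sum.cong) (auto simp: matvec_corner_matrix inner_on_def)
  then show ?thesis using assms by simp
qed

lemma quad_form_corner_matrix:
  "r \<in> {0..<p} \<Longrightarrow> quad_form (block_index p) (corner_matrix r r X) u = quad_form UNIV X (\<lambda>\<beta>. u (r, \<beta>))"
  by (simp add: quad_form_def inner_on_corner_matrix)

lemma trace_corner_matrix:
  assumes "r \<in> {0..<p}"
  shows "(\<Sum>i\<in>block_index p. corner_matrix r r X i i) = (\<Sum>\<beta>\<in>UNIV. X \<beta> \<beta>)"
proof -
  have "(\<Sum>i\<in>block_index p. corner_matrix r r X i i) = (\<Sum>t\<in>{0..<p}. \<Sum>\<beta>\<in>UNIV. corner_matrix r r X (t, \<beta>) (t, \<beta>))"
    unfolding block_index_def by (simp add: sum.cartesian_product case_prod_beta)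
  also have "\<dots> = (\<Sum>t\<in>{0..<p}. if t = r then \<Sum>\<beta>\<in>UNIV. X \<beta> \<beta> else 0)"
    by (intro sum.cong) (auto simp: corner_matrix_eq)
  finally show ?thesis using assms by simp
qed

lemma hermitian_corner_matrix: "hermitian_on UNIV X \<Longrightarrow> hermitian_on I (corner_matrix r r X)"
  unfolding hermitian_on_def corner_matrix_eq by (metis UNIV_I complex_cnj_zero)

lemma hermitian_add: "hermitian_on I M \<Longrightarrow> hermitian_on I N \<Longrightarrow> hermitian_on I (\<lambda>i j. M i j + N i j)"
  unfolding hermitian_on_def by (metis complex_cnj_add)

lemma hermitian_diff: "hermitian_on I M \<Longrightarrow> hermitian_on I N \<Longrightarrow> hermitian_on I (\<lambda>i j. M i j - N i j)"
  unfolding hermitian_on_def by (metis complex_cnj_diff)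

lemma spectrum_block_operator_measure:
  fixes T :: "(int \<Rightarrow> complex ^ 'm) \<Rightarrow> int \<Rightarrow> complex ^ 'm" and p c :: int and a :: "complex ^ 'm ^ 'm"
  defines "I \<equiv> block_index p :: (int \<times> 'm) set"
  defines "A \<equiv> corner_matrix (p - 1) 0 (mat_fun a)"
  assumes p: "p > 0" and M: "hermitian_on I M"
    and T: "\<And>y k i. i \<in> I \<Longrightarrow> seq_block p c (T y) k i =
      matvec I M (seq_block p c y k) i + matvec I A (seq_block p c y (k + 1)) i + matvec I (\<lambda>i j. cnj (A j i)) (seq_block p c y (k - 1)) i"
  shows "emeasure lborel {x::real. complex_of_real x \<in> spectrum T}
    \<le> ennreal (4 * Re (trace (psd_sqrt (conj_transpose a ** a))))"
proof -
  let ?R = "psd_sqrt (conj_transpose a ** a)"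
  have fin: "finite I" by (simp add: I_def)
  have r: "0 \<in> {0..<p}" "p - 1 \<in> {0..<p}" using p by auto
  obtain Q :: "'m \<Rightarrow> 'm \<Rightarrow> complex" where
    hR: "hermitian_on UNIV (mat_fun ?R)" and hQ: "hermitian_on UNIV Q"
    and trQ: "(\<Sum>i\<in>UNIV. Q i i) = trace ?R"
    and dom: "\<And>u w. 2 * \<bar>Re (inner_on UNIV (matvec UNIV (mat_fun a) w) u)\<bar> \<le> quad_form UNIV (mat_fun ?R) w + quad_form UNIV Q u"
    by (rule psd_sqrt_dominates[of a]) (rule that)
  \<comment> \<open>\<open>A\<close> carries the first site of the next block to the last site of
    the present one. So \<open>|a|\<close> is placed on the first site and \<open>Q\<close> on the
    last; for \<open>p = 1\<close> they share one site.\<close>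
  define D1 where "D1 = corner_matrix 0 0 (mat_fun ?R)"
  define D2 where "D2 = corner_matrix (p - 1) (p - 1) Q"
  have D: "2 * \<bar>Re (inner_on I (matvec I A w) u)\<bar> \<le> quad_form I D1 w + quad_form I D2 u" for u w
    unfolding I_def A_def D1_def D2_def inner_on_corner_matrix[OF r(2,1)] quad_form_corner_matrix[OF r(1)] quad_form_corner_matrix[OF r(2)]
    by (rule dom)
  have hD: "hermitian_on I (\<lambda>i j. D1 i j + D2 i j)"
    unfolding D1_def D2_def by (intro hermitian_add hermitian_corner_matrix hR hQ)
  define L where "L i j = M i j - (D1 i j + D2 i j)" for i j
  define U where "U i j = M i j + (D1 i j + D2 i j)" for i j
  have hL: "hermitian_on I L" unfolding L_def[abs_def] by (intro hermitian_diff M hD)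
  have hU: "hermitian_on I U" unfolding U_def[abs_def] by (intro hermitian_add M hD)
  obtain V :: "int \<times> 'm \<Rightarrow> int \<times> 'm \<Rightarrow> complex" and d :: "int \<times> 'm \<Rightarrow> real" where
    V: "\<And>k l. k \<in> I \<Longrightarrow> l \<in> I \<Longrightarrow> inner_on I (V k) (V l) = of_bool (k = l)"
    "\<And>k i. k \<in> I \<Longrightarrow> i \<in> I \<Longrightarrow> matvec I L (V k) i = d k * V k i"
    "\<And>i j. i \<in> I \<Longrightarrow> j \<in> I \<Longrightarrow> (\<Sum>k\<in>I. V k i * cnj (V k j)) = of_bool (i = j)"
    by (rule hermitian_spectral[OF fin hL]) (rule that)
  obtain V' :: "int \<times> 'm \<Rightarrow> int \<times> 'm \<Rightarrow> complex" and d' :: "int \<times> 'm \<Rightarrow> real" where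
    V': "\<And>k l. k \<in> I \<Longrightarrow> l \<in> I \<Longrightarrow> inner_on I (V' k) (V' l) = of_bool (k = l)"
    "\<And>k i. k \<in> I \<Longrightarrow> i \<in> I \<Longrightarrow> matvec I U (V' k) i = d' k * V' k i"
    "\<And>i j. i \<in> I \<Longrightarrow> j \<in> I \<Longrightarrow> (\<Sum>k\<in>I. V' k i * cnj (V' k j)) = of_bool (i = j)"
    by (rule hermitian_spectral[OF fin hU]) (rule that)
  have le: "quad_form I L u \<le> quad_form I U u" for u
    using D[of u u] abs_ge_zero[of "Re (inner_on I (matvec I A u) u)"]
    unfolding L_def[abs_def] U_def[abs_def] quad_form_mat_add quad_form_mat_diff by linarith
  have count_le: "card {k\<in>I. d' k < x} \<le> card {k\<in>I. d k < x}"
    if x: "\<forall>k\<in>I. d k \<noteq> x \<and> d' k \<noteq> x" for x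
    by (rule eigenvalue_count_le[OF fin V(1,2) V'(1,2) le]) (use x in auto)
  have gap: "complex_of_real x \<notin> spectrum T"
    if x: "\<forall>k\<in>I. d k \<noteq> x \<and> d' k \<noteq> x" and eq: "card {k\<in>I. d' k < x} = card {k\<in>I. d k < x}" for x
  proof -
    have "\<exists>S \<delta>. \<delta> > 0 \<and> (\<forall>u. \<exists>e f. (\<forall>i\<in>I. u i = e i + f i \<and> matvec I S u i = f i - e i) \<and>
        quad_form I U e \<le> (x - \<delta>) * normsq I e \<and> (x + \<delta>) * normsq I f \<le> quad_form I L f)"
      by (rule eigenvalue_gap_splitting[OF fin V(1,2) V'(1,2) le _ eq]) (use x in auto)
    then obtain S \<delta> where \<delta>: "\<delta> > 0" and
      S: "\<And>u. \<exists>e f. (\<forall>i\<in>I. u i = e i + f i \<and> matvec I S u i = f i - e i) \<and>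
        quad_form I U e \<le> (x - \<delta>) * normsq I e \<and> (x + \<delta>) * normsq I f \<le> quad_form I L f" by blast
    show ?thesis
    proof (rule block_coercive[OF fin M D \<delta> S[unfolded L_def[abs_def] U_def[abs_def]]])
      fix P \<epsilon> \<theta> C
      assume *: "0 < \<epsilon>" "\<And>z. (\<And>i. i \<in> I \<Longrightarrow> matvec I P z i = 0) \<Longrightarrow> \<forall>i\<in>I. z i = 0"
        "\<And>u0 u u1. \<epsilon> * normsq I u + \<theta> u0 u - \<theta> u u1 \<le> Re (inner_on I (matvec I P
           (\<lambda>i. matvec I M u i + matvec I A u1 i + matvec I (\<lambda>i j. cnj (A j i)) u0 i - of_real x * u i)) u)"
        "\<And>u0 u. \<bar>\<theta> u0 u\<bar> \<le> C * (normsq I u0 + normsq I u)"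
      show ?thesis
        by (rule block_operator_not_in_spectrum[OF p T[unfolded I_def] *[unfolded I_def]])
    qed
  qed
  have "emeasure lborel {x::real. complex_of_real x \<in> spectrum T} \<le> ennreal ((\<Sum>k\<in>I. d' k) - (\<Sum>k\<in>I. d k))"
  proof (rule emeasure_eigenvalue_count_le[OF fin _ count_le])
    fix x assume "x \<in> {x. complex_of_real x \<in> spectrum T}" and x: "\<forall>k\<in>I. d k \<noteq> x \<and> d' k \<noteq> x"
    with gap have "card {k\<in>I. d' k < x} \<noteq> card {k\<in>I. d k < x}" by blast
    with count_le[OF x] show "card {k\<in>I. d' k < x} < card {k\<in>I. d k < x}" by simp
  qed
  also have "(\<Sum>k\<in>I. d' k) - (\<Sum>k\<in>I. d k) = 4 * Re (trace ?R)"
  proof -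
    have "complex_of_real ((\<Sum>k\<in>I. d' k) - (\<Sum>k\<in>I. d k)) = (\<Sum>i\<in>I. U i i) - (\<Sum>i\<in>I. L i i)"
    proof -
      have "(\<Sum>i\<in>I. L i i) = of_real (\<Sum>k\<in>I. d k)"
        by (rule trace_eq_sum_eigenvalues[OF fin V])
      moreover have "(\<Sum>i\<in>I. U i i) = of_real (\<Sum>k\<in>I. d' k)"
        by (rule trace_eq_sum_eigenvalues[OF fin V'])
      ultimately show ?thesis by simp
    qed
    \<comment> \<open>\<open>M\<close> cancels, and each of the two corners is added in
      \<open>U\<close> and subtracted in \<open>L\<close>; this is the origin of the constant
      4.\<close>
    also have "\<dots> = 2 * ((\<Sum>i\<in>I. D1 i i) + (\<Sum>i\<in>I. D2 i i))"
      by (simp add: U_def L_def sum.distrib sum_subtractf)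
    also have "\<dots> = 4 * trace ?R"
      unfolding I_def D1_def D2_def trace_corner_matrix[OF r(1)] trace_corner_matrix[OF r(2)] trQ by (simp add: trace_def)
    finally have "Re (complex_of_real ((\<Sum>k\<in>I. d' k) - (\<Sum>k\<in>I. d k))) = Re (4 * trace ?R)" by simp
    then show ?thesis by simp
  qed
  finally show ?thesis .
qed

section \<open>The Jacobi operator in block form\<close>

lemma periodic_int_mult:
  fixes f :: "int \<Rightarrow> 'a" and p :: int
  assumes "\<And>n. f (n + p) = f n"
  shows "f (n + p * k) = f n"
proof (induction k rule: int_induct[where k = 0])
  case base
  then show ?case by simp
next
  case (step1 i)
  then show ?case using assms[of "n + p * i"] by (simp add: algebra_simps)
next
  case (step2 i)
  then show ?case using assms[of "n + p * (i - 1)"] by (simp add: algebra_simps)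
qed

lemma spectrum_jacobi_operator_measure:
  fixes a b :: "int \<Rightarrow> complex ^ 'm ^ 'm" and p n0 :: int
  assumes p: "p > 0"
    and a: "\<And>n. a (n + p) = a n" and b: "\<And>n. b (n + p) = b n"
    and herm: "\<And>n. conj_transpose (b n) = b n"
  shows "emeasure lborel {x::real. complex_of_real x \<in> spectrum (jacobi_operator a b)}
    \<le> ennreal (4 * Re (trace (psd_sqrt (conj_transpose (a n0) ** a n0))))"
proof -
  \<comment> \<open>Blocks start right after \<open>n0\<close>, so every block ends at a site
    congruent to \<open>n0\<close> modulo \<open>p\<close>, and consecutive blocks are coupled by
    \<open>a n0\<close>.\<close>
  let ?c = "n0 + 1"
  let ?I = "block_index p :: (int \<times> 'm) set"
  define A where "A = corner_matrix (p - 1) 0 (mat_fun (a n0))"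
  define M1 where "M1 = band_matrix (\<lambda>r. r) (\<lambda>r. mat_fun (b (?c + r)))"
  define M2 where "M2 = band_matrix (\<lambda>r. r + 1) (\<lambda>r. mat_fun (a (?c + r)))"
  define M3 where "M3 = band_matrix (\<lambda>r. r - 1) (\<lambda>r \<alpha> \<beta>. cnj (a (?c + r - 1) $ \<beta> $ \<alpha>))"
  define M where "M i j = M1 i j + (M2 i j + M3 i j)" for i j
  have b_cnj: "b n $ \<beta> $ \<alpha> = cnj (b n $ \<alpha> $ \<beta>)" for n \<alpha> \<beta>
    using herm[of n] unfolding conj_transpose_eq_iff_hermitian hermitian_on_def by (metis UNIV_I)
  have M: "hermitian_on ?I M"
    unfolding M_def[abs_def]
  proof (rule hermitian_add)
    show "hermitian_on ?I M1"
      unfolding hermitian_on_def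
    proof (intro ballI)
      fix i j :: "int \<times> 'm"
      show "M1 j i = cnj (M1 i j)"
        unfolding M1_def band_matrix_def
        by (cases "fst i = fst j") (simp_all, rule b_cnj)
    qed
    \<comment> \<open>\<open>M2\<close> couples to the right and \<open>M3\<close> to the left
      within a block; they are adjoint to each other.\<close>
    show "hermitian_on ?I (\<lambda>i j. M2 i j + M3 i j)"
      unfolding hermitian_on_def M2_def M3_def band_matrix_def by (auto simp: add_ac)
  qed
  have A_adj: "(\<lambda>i j. cnj (A j i)) = corner_matrix 0 (p - 1) (\<lambda>\<alpha> \<beta>. cnj (a n0 $ \<beta> $ \<alpha>))"
    by (auto simp: A_def corner_matrix_eq fun_eq_iff)
  have r: "0 \<in> {0..<p}" "p - 1 \<in> {0..<p}" using p by auto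
  have T: "seq_block p ?c (jacobi_operator a b y) k i = matvec ?I M (seq_block p ?c y k) i +
      matvec ?I A (seq_block p ?c y (k + 1)) i + matvec ?I (\<lambda>i j. cnj (A j i)) (seq_block p ?c y (k - 1)) i"
    if i: "i \<in> ?I" for y k i
  proof -
    obtain t \<alpha> where i_eq: "i = (t, \<alpha>)" by (cases i)
    have t: "0 \<le> t" "t < p" using i by (auto simp: i_eq block_index_def)
    define n where "n = ?c + t"
    define N where "N = ?c + p * k + t"
    have N: "N = n + p * k" by (simp add: N_def n_def)
    have aN: "a N = a n" "a (N - 1) = a (n - 1)" "b N = b n"
      using periodic_int_mult[of a p n k] periodic_int_mult[of a p "n - 1" k] periodic_int_mult[of b p n k] a b
      by (simp_all add: N algebra_simps)
    have 1: "matvec ?I M1 (seq_block p ?c y k) i = matvec UNIV (mat_fun (b n)) (\<lambda>\<beta>. y N $ \<beta>) \<alpha>"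
      using t by (simp add: M1_def matvec_band_matrix i_eq seq_block_def n_def N_def)
    have 2: "matvec ?I M2 (seq_block p ?c y k) i + matvec ?I A (seq_block p ?c y (k + 1)) i =
        matvec UNIV (mat_fun (a n)) (\<lambda>\<beta>. y (N + 1) $ \<beta>) \<alpha>"
    \<comment> \<open>At the last site the right neighbour opens block \<open>k + 1\<close>: there
      \<open>M2\<close> gives 0 and \<open>A\<close> takes over, while at all other sites
      \<open>A\<close> gives 0.\<close>
    proof (cases "t = p - 1")
      case True
      have "n = n0 + p * 1" using True by (simp add: n_def)
      then have "a n = a n0" using periodic_int_mult[of a p n0 1] a by simp
      moreover have "?c + p * (k + 1) + 0 = N + 1" using True by (simp add: N_def algebra_simps)
      then have "seq_block p ?c y (k + 1) (0, \<beta>) = y (N + 1) $ \<beta>" for \<beta>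
        by (simp only: seq_block_def fst_conv snd_conv)
      ultimately show ?thesis
        using True unfolding A_def matvec_corner_matrix[OF r(1)] by (simp add: M2_def matvec_band_matrix i_eq)
    next
      case False
      then show ?thesis
        using t unfolding A_def matvec_corner_matrix[OF r(1)]
        by (simp add: M2_def matvec_band_matrix i_eq seq_block_def n_def N_def algebra_simps)
    qed
    have 3: "matvec ?I M3 (seq_block p ?c y k) i + matvec ?I (\<lambda>i j. cnj (A j i)) (seq_block p ?c y (k - 1)) i =
        matvec UNIV (\<lambda>\<alpha> \<beta>. cnj (a (n - 1) $ \<beta> $ \<alpha>)) (\<lambda>\<beta>. y (N - 1) $ \<beta>) \<alpha>"
    \<comment> \<open>The mirror image: the left neighbour of the first site closes block
      \<open>k - 1\<close> and is reached through the adjoint of \<open>A\<close>.\<close>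
    proof (cases "t = 0")
      case True
      moreover have "?c + p * (k - 1) + (p - 1) = N - 1" using True by (simp add: N_def algebra_simps)
      ultimately show ?thesis
        unfolding A_adj matvec_corner_matrix[OF r(2)] by (simp add: M3_def matvec_band_matrix i_eq seq_block_def n_def)
    next
      case False
      then show ?thesis
        using t unfolding A_adj matvec_corner_matrix[OF r(2)]
        by (simp add: M3_def matvec_band_matrix i_eq seq_block_def n_def N_def algebra_simps)
    qed
    have "seq_block p ?c (jacobi_operator a b y) k i = jacobi_operator a b y N $ \<alpha>"
      by (simp add: seq_block_def i_eq N_def)
    also have "\<dots> = matvec UNIV (\<lambda>\<alpha> \<beta>. cnj (a (n - 1) $ \<beta> $ \<alpha>)) (\<lambda>\<beta>. y (N - 1) $ \<beta>) \<alpha>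
        + matvec UNIV (mat_fun (b n)) (\<lambda>\<beta>. y N $ \<beta>) \<alpha> + matvec UNIV (mat_fun (a n)) (\<lambda>\<beta>. y (N + 1) $ \<beta>) \<alpha>"
      by (simp add: jacobi_operator_def matrix_vector_mult_matvec aN mat_fun_conj_transpose)
    also have "\<dots> = matvec ?I M (seq_block p ?c y k) i + matvec ?I A (seq_block p ?c y (k + 1)) i + matvec ?I (\<lambda>i j. cnj (A j i)) (seq_block p ?c y (k - 1)) i"
      unfolding 1[symmetric] 2[symmetric] 3[symmetric] M_def[abs_def] matvec_mat_add by simp
    finally show ?thesis .
  qed
  show ?thesis
    by (rule spectrum_block_operator_measure[OF p M T[unfolded A_def]])
qed

theorem theorem1p2:
  fixes a b :: "int \<Rightarrow> complex ^ 'm ^ 'm" and p :: nat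
  assumes "p \<ge> 1"
    and "\<And>n. a (n + int p) = a n"
    and "\<And>n. b (n + int p) = b n"
    and "\<And>n. conj_transpose (b n) = b n"
  shows "emeasure lborel {x::real. complex_of_real x \<in> spectrum (jacobi_operator a b)}
    \<le> ennreal (4 * Min (range (\<lambda>n. Re (trace (psd_sqrt (conj_transpose (a n) ** a n))))))"
proof -
  define f where "f n = Re (trace (psd_sqrt (conj_transpose (a n) ** a n)))" for n
  \<comment> \<open>\<open>Min\<close> is meaningful on finite sets; by periodicity one period
    already gives all values, so the minimum is attained at a site where the lattice can be
    cut.\<close>
  have "range f \<subseteq> f ` {0..<int p}"
  proof clarify
    fix n
    have "f (n mod int p) = f (n mod int p + int p * (n div int p))"
      using assms(2) by (intro periodic_int_mult[symmetric]) (simp add: f_def)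
    then show "f n \<in> f ` {0..<int p}" using assms(1) by (intro image_eqI[of _ _ "n mod int p"]) auto
  qed
  then have "finite (range f)" by (rule finite_subset) simp
  then have "Min (range f) \<in> range f" by (intro Min_in) auto
  then obtain n0 where "Min (range f) = f n0" by auto
  then show ?thesis
    using spectrum_jacobi_operator_measure[of "int p" a b n0] assms by (simp add: f_def[abs_def])
qed

end
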